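(* There is an algorithm and an absolute constant $C$ such that the following holds. Given as input an undirected unweighted graph $G$ on $n$ vertices, a set $F$ of $f$ edges of $G$, a shortest path $\pi$ in $G \setminus F$, and a positive integer parameter $k$, the algorithm returns a partition $\pi = \pi_0 \circ \pi_1 \circ \dots \circ \pi_q$ of $\pi$ into consecutive subpaths with $q \le Ck$, together with fault sets $F_0, \dots, F_q \subseteq F$ with $|F_i| \le f/k$ for every $i$, such that each $\pi_i$ is a shortest path in $G \setminus F_i$. The algorithm runs in time polynomial in $n$ and $f$.
   Context: All graphs are finite, undirected and unweighted. A partition of a path into consecutive subpaths $\pi_0 \circ \dots \circ \pi_q$ means the subpaths appear in order along $\pi$, consecutive subpaths share their boundary vertex, and their concatenation is $\pi$. *)

theory Defs
  imports Complex_Main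
begin

section \<open>Graphs and shortest paths\<close>

definition ugraph :: "'a set \<Rightarrow> 'a set set \<Rightarrow> bool" where
  "ugraph V E \<longleftrightarrow> finite V \<and> (\<forall>e\<in>E. e \<subseteq> V \<and> card e = 2)"

text \<open>Paths are non-empty lists of pairwise distinct vertices. A single vertex is a path
  (with no edges).\<close>

definition is_path :: "'a set \<Rightarrow> 'a set set \<Rightarrow> 'a list \<Rightarrow> bool" where
  "is_path V E p \<longleftrightarrow> p \<noteq> [] \<and> set p \<subseteq> V \<and> distinct p
     \<and> (\<forall>i. Suc i < length p \<longrightarrow> {p ! i, p ! Suc i} \<in> E)"

text \<open>The number of edges of a path is one less than the length of its vertex list, so
  comparing list lengths compares path lengths.\<close>

definition shortest_path :: "'a set \<Rightarrow> 'a set set \<Rightarrow> 'a list \<Rightarrow> bool" where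
  "shortest_path V E p \<longleftrightarrow> is_path V E p
     \<and> (\<forall>r. is_path V E r \<and> hd r = hd p \<and> last r = last p \<longrightarrow> length p \<le> length r)"

text \<open>Consecutive parts share their boundary vertex, which the concatenation must list only
  once; hence the \<open>tl\<close>.\<close>

definition path_partition :: "'a list \<Rightarrow> 'a list list \<Rightarrow> bool" where
  "path_partition p ps \<longleftrightarrow> ps \<noteq> [] \<and> (\<forall>r\<in>set ps. r \<noteq> [])
     \<and> (\<forall>i. Suc i < length ps \<longrightarrow> last (ps ! i) = hd (ps ! Suc i))
     \<and> p = hd ps @ concat (map tl (tl ps))"

section \<open>Machine model\<close>

text \<open>
  Algorithms are programs of a random access machine with structured control flow: finitely
  many scalar registers and arrays of natural numbers, under the uniform cost measure. The only
  arithmetic is addition and truncated subtraction. Without a unit-cost multiplication, numbers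
  grow by at most a constant number of bits per step, so running times agree with those of
  Turing machines up to a polynomial.
\<close>

type_synonym vname = string

datatype aexp =
    Const nat
  | Var vname
  | Elem vname aexp
  | Add aexp aexp
  | Sub aexp aexp

datatype bexp =
    Less aexp aexp
  | Equal aexp aexp
  | Neg bexp
  | Conj bexp bexp

datatype com =
    Skip
  | Assign vname aexp
  | Store vname aexp aexp
  | Seq com com
  | Cond bexp com com
  | While bexp com

record state =
  scalar :: "vname \<Rightarrow> nat"
  arr :: "vname \<Rightarrow> nat \<Rightarrow> nat"

fun aval :: "aexp \<Rightarrow> state \<Rightarrow> nat" where
  "aval (Const m) s = m"
| "aval (Var x) s = scalar s x"
| "aval (Elem a e) s = arr s a (aval e s)"
| "aval (Add e1 e2) s = aval e1 s + aval e2 s"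
| "aval (Sub e1 e2) s = aval e1 s - aval e2 s"

fun bval :: "bexp \<Rightarrow> state \<Rightarrow> bool" where
  "bval (Less e1 e2) s \<longleftrightarrow> aval e1 s < aval e2 s"
| "bval (Equal e1 e2) s \<longleftrightarrow> aval e1 s = aval e2 s"
| "bval (Neg b) s \<longleftrightarrow> \<not> bval b s"
| "bval (Conj b1 b2) s \<longleftrightarrow> bval b1 s \<and> bval b2 s"

fun acost :: "aexp \<Rightarrow> nat" where
  "acost (Const m) = 1"
| "acost (Var x) = 1"
| "acost (Elem a e) = acost e + 1"
| "acost (Add e1 e2) = acost e1 + acost e2 + 1"
| "acost (Sub e1 e2) = acost e1 + acost e2 + 1"

fun bcost :: "bexp \<Rightarrow> nat" where
  "bcost (Less e1 e2) = acost e1 + acost e2 + 1"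
| "bcost (Equal e1 e2) = acost e1 + acost e2 + 1"
| "bcost (Neg b) = bcost b + 1"
| "bcost (Conj b1 b2) = bcost b1 + bcost b2 + 1"

text \<open>\<open>exec c s t s'\<close>: started in \<open>s\<close>, the program \<open>c\<close> halts in \<open>s'\<close> after \<open>t\<close> steps.\<close>

inductive exec :: "com \<Rightarrow> state \<Rightarrow> nat \<Rightarrow> state \<Rightarrow> bool" where
  Skip: "exec Skip s 1 s"
| Assign: "exec (Assign x e) s (acost e + 1) (s\<lparr>scalar := (scalar s)(x := aval e s)\<rparr>)"
| Store: "exec (Store a i e) s (acost i + acost e + 1)
    (s\<lparr>arr := (arr s)(a := (arr s a)(aval i s := aval e s))\<rparr>)"
| Seq: "exec c1 s1 t1 s2 \<Longrightarrow> exec c2 s2 t2 s3 \<Longrightarrow> exec (Seq c1 c2) s1 (t1 + t2) s3"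
| CondTrue: "bval b s \<Longrightarrow> exec c1 s t s' \<Longrightarrow> exec (Cond b c1 c2) s (bcost b + t + 1) s'"
| CondFalse: "\<not> bval b s \<Longrightarrow> exec c2 s t s' \<Longrightarrow> exec (Cond b c1 c2) s (bcost b + t + 1) s'"
| WhileFalse: "\<not> bval b s \<Longrightarrow> exec (While b c) s (bcost b + 1) s"
| WhileTrue: "bval b s1 \<Longrightarrow> exec c s1 t1 s2 \<Longrightarrow> exec (While b c) s2 t2 s3
    \<Longrightarrow> exec (While b c) s1 (bcost b + t1 + t2 + 1) s3"

text \<open>The input word is found in the array \<open>input\<close>, its length in the scalar of the same name;
  all other memory is zero. The output is delivered in the same way under the name \<open>output\<close>.\<close>

definition init_state :: "nat list \<Rightarrow> state" where
  "init_state xs = \<lparr>scalar = (\<lambda>_. 0)(''input'' := length xs),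
     arr = (\<lambda>_ _. 0)(''input'' := (\<lambda>i. if i < length xs then xs ! i else 0))\<rparr>"

definition output_of :: "state \<Rightarrow> nat list" where
  "output_of s = map (arr s ''output'') [0..<scalar s ''output'']"

definition computes_in :: "com \<Rightarrow> nat list \<Rightarrow> nat list \<Rightarrow> nat \<Rightarrow> bool" where
  "computes_in c xs ys t \<longleftrightarrow> (\<exists>s. exec c (init_state xs) t s \<and> output_of s = ys)"

section \<open>Encoding of inputs and outputs\<close>

definition edge_set :: "('a \<times> 'a) list \<Rightarrow> 'a set set" where
  "edge_set es = (\<lambda>(u, v). {u, v}) ` set es"

text \<open>Each edge is listed once, in one arbitrary orientation.\<close>

definition lists_edges :: "('a \<times> 'a) list \<Rightarrow> 'a set set \<Rightarrow> bool" where
  "lists_edges es E \<longleftrightarrow> edge_set es = E \<and> distinct (map (\<lambda>(u, v). {u, v}) es)"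

definition enc_path :: "nat list \<Rightarrow> nat list" where
  "enc_path p = length p # p"

definition enc_edges :: "(nat \<times> nat) list \<Rightarrow> nat list" where
  "enc_edges es = length es # concat (map (\<lambda>(u, v). [u, v]) es)"

text \<open>The vertices of the input graph are \<open>0, \<dots>, n - 1\<close>.\<close>

definition enc_input ::
    "nat \<Rightarrow> (nat \<times> nat) list \<Rightarrow> (nat \<times> nat) list \<Rightarrow> nat list \<Rightarrow> nat \<Rightarrow> nat list" where
  "enc_input n es fs p k = n # enc_edges es @ enc_edges fs @ enc_path p @ [k]"

text \<open>The output is a sequence of subpaths, each accompanied by its fault set.\<close>

definition enc_output :: "(nat list \<times> (nat \<times> nat) list) list \<Rightarrow> nat list" where
  "enc_output out = length out # concat (map (\<lambda>(p, fs). enc_path p @ enc_edges fs) out)"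

end

theory Submission
  imports Defs
begin

text \<open>
  Let \<open>\<sigma>\<close> be a subpath of \<open>\<pi>\<close> of length \<open>D\<close> and let \<open>c\<close> be one of its two ends. Deleting only the
  faults that touch the open ball of radius \<open>D\<close> around \<open>c\<close>, taken in \<open>G \<setminus> F\<close>, leaves \<open>\<sigma>\<close>
  shortest: a path starting at \<open>c\<close> can then only use surviving edges until it has left the ball.
  Call \<open>\<sigma>\<close> bad if for both ends more than \<open>f / k\<close> faults are touched. Extend the current piece
  greedily while it is not bad. When it becomes bad, close the piece one vertex earlier, add the
  last edge as a piece of its own (it needs no faults), and start afresh. Among any two
  consecutive bad intervals, the ball around their common end with the length of the shorter one
  as radius stays between their outer ends, so the balls of disjoint pairs are disjoint. As a
  fault has two ends, it touches at most two of these balls; hence there are fewer than \<open>2 k\<close>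
  pairs.
\<close>

section \<open>Balls of faults along a shortest path\<close>

text \<open>A single bad interval bounds nothing. The ball around one of its ends reaches as far
  beyond that end as the interval is long, so balls of different intervals may overlap and one fault
  may be charged many times. A centre has room on both sides only where two bad intervals meet, and
  only up to the shorter length. Which of the two is shorter is not known when a piece is closed, so
  both ends of a bad interval must fail as centres. The emitted pieces stop one vertex before the
  bad intervals do; the bad intervals share their ends, and it is they that are counted. The
  constant 8: fewer than 2 k pairs leave at most 4 k - 1 bad intervals, one of them perhaps
  unpaired. Each accounts for two emitted pieces, a good one and an edge. The piece still open at
  the end of the path is the one part beyond these.\<close>

definition adj :: "'a set set \<Rightarrow> ('a \<times> 'a) set" where
  "adj H = {(u, v). {u, v} \<in> H}"

text \<open>Stated with walks, so that unreachable vertices need no infinite distance. The ball is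
  open: a path from \<open>c\<close> with fewer than \<open>r\<close> edges then lies in it
  entirely.\<close>

definition ball :: "'a set set \<Rightarrow> 'a \<Rightarrow> nat \<Rightarrow> 'a set" where
  "ball H c r = {v. \<exists>l<r. (c, v) \<in> adj H ^^ l}"

definition subpath :: "'a list \<Rightarrow> nat \<Rightarrow> nat \<Rightarrow> 'a list" where
  "subpath p a b = take (Suc b - a) (drop a p)"

text \<open>A list in the order and orientation of \<open>fs\<close>, because this is the very
  sequence that the program writes.\<close>

definition touching :: "'a set set \<Rightarrow> ('a \<times> 'a) list \<Rightarrow> 'a \<Rightarrow> nat \<Rightarrow> ('a \<times> 'a) list" where
  "touching H fs c r = filter (\<lambda>(u, v). u \<in> ball H c r \<or> v \<in> ball H c r) fs"

section \<open>Walks and simple paths\<close>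

lemma relpow_adj_sym: "(u, v) \<in> adj H ^^ l \<Longrightarrow> (v, u) \<in> adj H ^^ l"
proof (induction l arbitrary: v)
  case (Suc l)
  then obtain w where "(u, w) \<in> adj H ^^ l" "(w, v) \<in> adj H" by auto
  then have "(w, u) \<in> adj H ^^ l" "(v, w) \<in> adj H"
    using Suc.IH by (auto simp: adj_def insert_commute)
  then show ?case by (meson relpow_Suc_I2)
qed simp

text \<open>Walks can be concatenated freely, but \<open>shortest_path\<close> compares simple paths
  only; this is the passage between them. A step to a vertex visited before cuts the path back to
  that vertex, which never lengthens it.\<close>

lemma path_of_walk:
  assumes "ugraph V E" "u \<in> V" "(u, v) \<in> adj E ^^ l"
  shows "\<exists>r. is_path V E r \<and> hd r = u \<and> last r = v \<and> length r \<le> Suc l"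
  using assms(3)
proof (induction l arbitrary: v)
  case 0
  then show ?case using assms(2) by (intro exI[of _ "[u]"]) (auto simp: is_path_def)
next
  case (Suc l)
  then obtain w where w: "(u, w) \<in> adj E ^^ l" "{w, v} \<in> E" by (auto simp: adj_def)
  from Suc.IH[OF w(1)] obtain r where
    r: "is_path V E r" "hd r = u" "last r = w" "length r \<le> Suc l" by blast
  show ?case
  proof (cases "v \<in> set r")
    case True
    then obtain xs ys where xs: "r = xs @ v # ys" by (meson split_list)
    have "\<And>i. Suc i < length (xs @ [v]) \<Longrightarrow>
        (xs @ [v]) ! i = r ! i \<and> (xs @ [v]) ! Suc i = r ! Suc i \<and> Suc i < length r"
      unfolding xs by (auto simp: nth_append less_Suc_eq)
    then have "is_path V E (xs @ [v])" using r(1) unfolding is_path_def by (auto simp: xs)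
    then show ?thesis using r xs by (intro exI[of _ "xs @ [v]"]) (auto simp: hd_append)
  next
    case False
    have "v \<in> V" using assms(1) w(2) by (auto simp: ugraph_def)
    moreover have "r ! (length r - 1) = w" using r(1,3) by (simp add: is_path_def last_conv_nth)
    then have "{(r @ [v]) ! i, (r @ [v]) ! Suc i} \<in> E" if "Suc i < length (r @ [v])" for i
      using that r(1) w(2) by (cases "i = length r - 1") (auto simp: is_path_def nth_append)
    ultimately have "is_path V E (r @ [v])" using r(1) False by (auto simp: is_path_def)
    then show ?thesis using r by (intro exI[of _ "r @ [v]"]) (auto simp: is_path_def)
  qed
qed

lemma walk_of_path:
  assumes "is_path V E r" "i \<le> j" "j < length r"
  shows "(r ! i, r ! j) \<in> adj E ^^ (j - i)"
  using assms(2,3)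
proof (induction j rule: dec_induct)
  case (step j)
  then have "(r ! i, r ! j) \<in> adj E ^^ (j - i)" "(r ! j, r ! Suc j) \<in> adj E"
    using assms(1) by (auto simp: is_path_def adj_def)
  then have "(r ! i, r ! Suc j) \<in> adj E ^^ Suc (j - i)" by auto
  then show ?case using step.hyps by (simp add: Suc_diff_le)
qed simp

text \<open>The walk, put in place of the stretch from \<open>i\<close> to \<open>j\<close>, joins
  the ends of \<open>p\<close>; the simple path obtained from the result has at least as many
  vertices as \<open>p\<close>.\<close>

lemma shortest_path_walk_ge:
  assumes G: "ugraph V E" and p: "shortest_path V E p" and ij: "i \<le> j" "j < length p"
    and walk: "(p ! i, p ! j) \<in> adj E ^^ l"
  shows "j - i \<le> l"
proof -
  have path: "is_path V E p" using p by (simp add: shortest_path_def)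
  have "(p ! 0, p ! i) \<in> adj E ^^ i" using walk_of_path[OF path, of 0 i] ij by simp
  moreover have "(p ! j, p ! (length p - 1)) \<in> adj E ^^ (length p - 1 - j)"
    using walk_of_path[OF path, of j "length p - 1"] ij by simp
  ultimately have "(p ! 0, p ! (length p - 1)) \<in> adj E ^^ (i + l + (length p - 1 - j))"
    using walk relpow_trans by meson
  then have "(hd p, last p) \<in> adj E ^^ (i + l + (length p - 1 - j))"
    using path by (simp add: is_path_def hd_conv_nth last_conv_nth)
  moreover have "hd p \<in> V" using path by (auto simp: is_path_def)
  ultimately obtain r where "is_path V E r" "hd r = hd p" "last r = last p"
    "length r \<le> Suc (i + l + (length p - 1 - j))"
    using path_of_walk[OF G] by blast
  then have "length p \<le> Suc (i + l + (length p - 1 - j))"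
    using p unfolding shortest_path_def by fastforce
  then show ?thesis using ij by linarith
qed

section \<open>Subpaths and the faults that must be removed for them\<close>

lemma length_subpath: "b < length p \<Longrightarrow> length (subpath p a b) = Suc b - a"
  by (auto simp: subpath_def)

lemma subpath_nth: "i \<le> b - a \<Longrightarrow> a \<le> b \<Longrightarrow> b < length p \<Longrightarrow> subpath p a b ! i = p ! (a + i)"
  by (auto simp: subpath_def)

lemma subpath_neq_Nil: "a \<le> b \<Longrightarrow> b < length p \<Longrightarrow> subpath p a b \<noteq> []"
  by (auto simp: subpath_def)

lemma hd_subpath: "a \<le> b \<Longrightarrow> b < length p \<Longrightarrow> hd (subpath p a b) = p ! a"
  by (simp add: hd_conv_nth subpath_neq_Nil subpath_nth)

lemma last_subpath: "a \<le> b \<Longrightarrow> b < length p \<Longrightarrow> last (subpath p a b) = p ! b"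
  by (simp add: last_conv_nth subpath_neq_Nil subpath_nth length_subpath)

lemma is_path_subpath:
  assumes "is_path V E p" "a \<le> b" "b < length p"
  shows "is_path V E (subpath p a b)"
proof -
  have "set (subpath p a b) \<subseteq> set p"
    unfolding subpath_def by (meson order_trans set_take_subset set_drop_subset)
  moreover have "{subpath p a b ! i, subpath p a b ! Suc i} \<in> E"
    if "Suc i < length (subpath p a b)" for i
    using that assms by (simp add: length_subpath subpath_nth is_path_def)
  ultimately show ?thesis
    using assms subpath_neq_Nil[OF assms(2,3)]
    by (auto simp: is_path_def subpath_def)
qed

lemma is_path_mono: "is_path V E p \<Longrightarrow> E \<subseteq> E' \<Longrightarrow> is_path V E' p"
  by (auto simp: is_path_def)

lemma is_path_rev:
  assumes "is_path V E p"
  shows "is_path V E (rev p)"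
proof -
  have "{rev p ! i, rev p ! Suc i} \<in> E" if "Suc i < length p" for i
  proof -
    have "{p ! (length p - Suc (Suc i)), p ! Suc (length p - Suc (Suc i))} \<in> E"
      using assms that unfolding is_path_def by (metis Suc_diff_Suc diff_less zero_less_Suc less_trans_Suc Suc_lessD)
    then show ?thesis using that by (simp add: rev_nth Suc_diff_Suc insert_commute)
  qed
  then show ?thesis using assms by (auto simp: is_path_def)
qed

text \<open>An edge that survives the deletion and has an end in the ball is not a fault. While
  fewer than \<open>D\<close> steps have been made, the current vertex is in the ball, so the next
  step stays in \<open>E - F\<close>.\<close>

lemma path_in_ball:
  assumes "is_path V (E - {e \<in> F. e \<inter> ball (E - F) (hd r) D \<noteq> {}}) r" "i < length r" "i < D"
  shows "(hd r, r ! i) \<in> adj (E - F) ^^ i"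
  using assms(2,3)
proof (induction i)
  case 0
  then show ?case by (simp add: hd_conv_nth)
next
  case (Suc i)
  then have walk: "(hd r, r ! i) \<in> adj (E - F) ^^ i" by simp
  moreover have "r ! i \<in> ball (E - F) (hd r) D"
    using walk Suc.prems(2) Suc_lessD unfolding ball_def by blast
  moreover have "{r ! i, r ! Suc i} \<in> E - {e \<in> F. e \<inter> ball (E - F) (hd r) D \<noteq> {}}"
    using assms(1) Suc.prems by (simp add: is_path_def)
  ultimately have "(r ! i, r ! Suc i) \<in> adj (E - F)" by (auto simp: adj_def)
  then show ?case using walk by auto
qed

text \<open>A competitor with fewer than \<open>b - a\<close> edges is too short to leave the ball.
  It therefore lives in \<open>E - F\<close>, where \<open>p\<close> has no shortcut.\<close>

lemma shortest_subpath:
  assumes G: "ugraph V E" and p: "shortest_path V (E - F) p" and ab: "a \<le> b" "b < length p"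
    and c: "c = p ! a \<or> c = p ! b"
    and F': "F' = {e \<in> F. e \<inter> ball (E - F) c (b - a) \<noteq> {}}"
  shows "shortest_path V (E - F') (subpath p a b)"
proof -
  have G': "ugraph V (E - F)" using G by (auto simp: ugraph_def)
  have "is_path V (E - F) p" using p by (simp add: shortest_path_def)
  then have "is_path V (E - F') (subpath p a b)"
    using ab F' by (intro is_path_mono[OF is_path_subpath]) auto
  moreover have "length (subpath p a b) \<le> length r"
    if r: "is_path V (E - F') r" "hd r = p ! a" "last r = p ! b" for r
  proof (rule ccontr)
    assume "\<not> length (subpath p a b) \<le> length r"
    moreover from r(1) have ne: "r \<noteq> []" by (simp add: is_path_def)
    ultimately have short: "length r - 1 < b - a"
      using ab by (cases r) (auto simp: length_subpath)
    \<comment> \<open>\<open>path_in_ball\<close> measures from the head, so the competitor is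
      reversed when the centre is the right end.\<close>
    define r' where "r' = (if c = p ! a then r else rev r)"
    have r': "is_path V (E - F') r'" "length r' = length r" "hd r' = c"
      using r c is_path_rev by (auto simp: r'_def hd_rev)
    then have "(c, r' ! (length r - 1)) \<in> adj (E - F) ^^ (length r - 1)"
      using path_in_ball[of V E F r' "b - a" "length r - 1"] short ne F' by auto
    moreover have "r' \<noteq> []" using r'(2) ne by force
    then have "r' ! (length r - 1) = last r'"
      using r'(2) by (simp add: last_conv_nth)
    ultimately have "(hd r', last r') \<in> adj (E - F) ^^ (length r - 1)"
      using r'(3) by simp
    then have "(p ! a, p ! b) \<in> adj (E - F) ^^ (length r - 1)"
      using r(2,3) relpow_adj_sym by (auto simp: r'_def hd_rev last_rev split: if_splits)
    from shortest_path_walk_ge[OF G' p ab this] short show False by simp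
  qed
  ultimately show ?thesis
    using ab by (auto simp: shortest_path_def hd_subpath last_subpath)
qed

text \<open>The two ends differ, so no competitor is a single vertex. This is why an edge that forms
  a piece of its own can carry the empty fault set.\<close>

lemma shortest_subpath_edge:
  assumes p: "is_path V E p" and a: "Suc a < length p"
  shows "shortest_path V E (subpath p a (Suc a))"
proof -
  have "2 \<le> length r" if "is_path V E r" "hd r = p ! a" "last r = p ! Suc a" for r
  proof -
    have "p ! a \<noteq> p ! Suc a" using p a by (simp add: is_path_def nth_eq_iff_index_eq)
    then show ?thesis using that by (cases r rule: list.exhaust) (auto simp: is_path_def Suc_le_eq)
  qed
  then show ?thesis
    using a is_path_subpath[OF p, of a "Suc a"]
    by (auto simp: shortest_path_def hd_subpath last_subpath length_subpath)
qed

section \<open>Disjoint balls and the number of bad intervals\<close>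

lemma disjoint_balls:
  assumes G: "ugraph V E" and p: "shortest_path V E p" and ij: "j < length p" "i + D + D' \<le> j"
  shows "ball E (p ! i) D \<inter> ball E (p ! j) D' = {}"
proof (rule ccontr)
  assume "\<not> ?thesis"
  then obtain v l l' where l: "l < D" "l' < D'" "(p ! i, v) \<in> adj E ^^ l" "(p ! j, v) \<in> adj E ^^ l'"
    unfolding ball_def by blast
  \<comment> \<open>A common vertex joins the two centres by a walk shorter than their distance
    along \<open>p\<close>.\<close>
  then have "(p ! i, p ! j) \<in> adj E ^^ (l + l')"
    using relpow_trans[OF l(3) relpow_adj_sym[OF l(4)]] by simp
  from shortest_path_walk_ge[OF G p _ _ this] ij l(1,2) show False by simp
qed

text \<open>Double counting: a ball touched by \<open>e\<close> contains at least one end of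
  \<open>e\<close>, and by disjointness each of the two ends counts for one ball only.\<close>

lemma card_touched_disjoint:
  fixes m :: nat
  assumes "finite F" "\<forall>e\<in>F. card e = 2"
    and disj: "\<And>i j. i < m \<Longrightarrow> j < i \<Longrightarrow> B i \<inter> B j = {}"
  shows "(\<Sum>i<m. card {e \<in> F. e \<inter> B i \<noteq> {}}) \<le> 2 * card F"
proof -
  have fin: "finite e" if "e \<in> F" for e using assms(2) that card_ge_0_finite by force
  have "(\<Sum>i<m. card {e \<in> F. e \<inter> B i \<noteq> {}}) = (\<Sum>i<m. \<Sum>e\<in>F. if e \<inter> B i \<noteq> {} then 1 else 0)"
    using assms(1) by (simp flip: sum.inter_filter)
  also have "\<dots> \<le> (\<Sum>i<m. \<Sum>e\<in>F. card (e \<inter> B i))"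
    using fin by (intro sum_mono) (auto simp: Suc_le_eq card_gt_0_iff)
  also have "\<dots> = (\<Sum>e\<in>F. \<Sum>i<m. card (e \<inter> B i))" by (rule sum.swap)
  also have "\<dots> \<le> (\<Sum>e\<in>F. 2)"
  proof (rule sum_mono)
    fix e assume e: "e \<in> F"
    have "(\<Sum>i<m. card (e \<inter> B i)) = card (\<Union>i<m. e \<inter> B i)"
    proof (rule card_UN_disjoint[symmetric])
      show "\<forall>i\<in>{..<m}. \<forall>j\<in>{..<m}. i \<noteq> j \<longrightarrow> e \<inter> B i \<inter> (e \<inter> B j) = {}"
      proof (intro ballI impI)
        fix i j assume "i \<in> {..<m}" "j \<in> {..<m}" "i \<noteq> j"
        then have "B i \<inter> B j = {}" using disj[of i j] disj[of j i] by (cases i j rule: linorder_cases) auto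
        then show "e \<inter> B i \<inter> (e \<inter> B j) = {}" by blast
      qed
    qed (use fin[OF e] in auto)
    also have "\<dots> \<le> card e" using fin[OF e] by (intro card_mono) auto
    finally show "(\<Sum>i<m. card (e \<inter> B i)) \<le> 2" using assms(2) e by simp
  qed
  finally show ?thesis by simp
qed

lemma edge_set_touching:
  "edge_set (touching H fs c r) = {e \<in> edge_set fs. e \<inter> ball H c r \<noteq> {}}"
proof -
  have "{u, v} \<inter> ball H c r \<noteq> {} \<longleftrightarrow> u \<in> ball H c r \<or> v \<in> ball H c r" for u v by blast
  then show ?thesis unfolding edge_set_def touching_def by (auto simp: image_iff Bex_def)
qed

lemma length_lists_edges: "lists_edges fs F \<Longrightarrow> length fs = card F"
  unfolding lists_edges_def edge_set_def using distinct_card by fastforce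

text \<open>The program counts list entries, the argument counts edges; they agree because each
  fault is listed once.\<close>

lemma length_touching:
  assumes "lists_edges fs F"
  shows "length (touching H fs c r) = card {e \<in> F. e \<inter> ball H c r \<noteq> {}}"
proof -
  have "lists_edges (touching H fs c r) (edge_set (touching H fs c r))"
    using assms by (simp add: lists_edges_def touching_def distinct_map_filter)
  from length_lists_edges[OF this] show ?thesis
    using assms by (simp add: edge_set_touching lists_edges_def)
qed

text \<open>Consecutive entries of \<open>bs\<close> enclose a bad interval. Intervals
  \<open>2 * i\<close> and \<open>Suc (2 * i)\<close> form a pair with common end
  \<open>c i\<close>. Badness is required at both ends because \<open>c i\<close> is the right end
  of one interval and the left end of the other, and the minimum \<open>D i\<close> may come from
  either.\<close>

lemma few_bad_intervals:
  assumes G: "ugraph V E" and F: "F \<subseteq> E" "lists_edges fs F"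
    and p: "shortest_path V (E - F) p"
    and sorted: "sorted_wrt (<) bs" and bs: "\<forall>b\<in>set bs. b < length p"
    and bad: "\<And>i c. Suc i < length bs \<Longrightarrow> c = p ! (bs ! i) \<or> c = p ! (bs ! Suc i) \<Longrightarrow>
       length fs div k < length (touching (E - F) fs c (bs ! Suc i - bs ! i))"
    and k: "1 \<le> k"
  shows "length bs \<le> 4 * k"
proof -
  \<comment> \<open>There are \<open>length bs - 1\<close> intervals; if their number is odd, the
    last one stays unpaired.\<close>
  define m where "m = (length bs - 1) div 2"
  define c where "c i = p ! (bs ! Suc (2 * i))" for i
  define D where "D i = min (bs ! Suc (2 * i) - bs ! (2 * i))
      (bs ! Suc (Suc (2 * i)) - bs ! Suc (2 * i))" for i
  have G': "ugraph V (E - F)" using G by (auto simp: ugraph_def)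
  have ix: "Suc (Suc (2 * i)) < length bs" if "i < m" for i
    using that by (auto simp: m_def)
  have le: "bs ! i \<le> bs ! j" if "i \<le> j" "j < length bs" for i j
    using sorted that by (cases "i = j") (auto simp: sorted_wrt_iff_nth_less less_imp_le)
  have big: "length fs div k < card {e \<in> F. e \<inter> ball (E - F) (c i) (D i) \<noteq> {}}" if "i < m" for i
    using bad[of "2 * i" "c i"] bad[of "Suc (2 * i)" "c i"] ix[OF that]
    by (simp add: D_def c_def min_def flip: length_touching[OF F(2)])
  have disj: "ball (E - F) (c i) (D i) \<inter> ball (E - F) (c j) (D j) = {}" if "i < m" "j < i" for i j
  proof -
    \<comment> \<open>The radius \<open>D j\<close> does not reach beyond
      \<open>bs ! (2 * j + 2)\<close>, nor \<open>D i\<close> below \<open>bs ! (2 * i)\<close>, and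
      \<open>j < i\<close> puts these two points in order.\<close>
    have "bs ! Suc (2 * j) + D j + D i \<le> bs ! Suc (2 * i)"
      using ix[OF that(1)] ix[of j] that le[of "2 * j + 2" "2 * i"]
        le[of "2 * i" "Suc (2 * i)"] le[of "Suc (2 * j)" "2 * j + 2"]
      by (simp add: D_def)
    then have "ball (E - F) (c j) (D j) \<inter> ball (E - F) (c i) (D i) = {}"
      unfolding c_def using bs ix[OF that(1)] by (intro disjoint_balls[OF G' p]) auto
    then show ?thesis by blast
  qed
  have "E \<subseteq> Pow V" "finite (Pow V)" using G by (auto simp: ugraph_def)
  then have "finite E" by (rule finite_subset)
  then have "finite F" using F(1) finite_subset by blast
  have "m * Suc (length fs div k) \<le> (\<Sum>i<m. card {e \<in> F. e \<inter> ball (E - F) (c i) (D i) \<noteq> {}})"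
    using big sum_bounded_below[of "{..<m}" "Suc (length fs div k)"] by (simp add: Suc_le_eq)
  also have "\<dots> \<le> 2 * card F"
    using \<open>finite F\<close> F(1) G disj by (intro card_touched_disjoint) (auto simp: ugraph_def)
  \<comment> \<open>Strict even when \<open>k\<close> divides the number of faults, since badness
    means at least \<open>Suc (length fs div k)\<close> touched faults.\<close>
  also have "\<dots> < 2 * k * Suc (length fs div k)"
    using k dividend_less_times_div[of k "length fs"] length_lists_edges[OF F(2)] by simp
  finally have "m < 2 * k" by (simp only: mult_less_cancel2)
  \<comment> \<open>At most 2 k - 1 pairs and one unpaired interval make 4 k - 1 intervals, hence 4
    k break points.\<close>
  then show ?thesis by (simp add: m_def)
qed

section \<open>Gluing pieces into a partition\<close>

lemma path_partition_snoc:
  assumes "path_partition p ps" "r \<noteq> []" "hd r = last p"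
  shows "path_partition (p @ tl r) (ps @ [r])"
proof -
  \<comment> \<open>The glued path ends where its last part ends, even if that part is a single
    vertex and contributes nothing to the concatenation.\<close>
  have last: "last (hd ps @ concat (map tl (tl ps))) = last (last ps)" if "ps \<noteq> []"
    "\<forall>r\<in>set ps. r \<noteq> []" "\<forall>i. Suc i < length ps \<longrightarrow> last (ps ! i) = hd (ps ! Suc i)" for ps :: "'a list list"
    using that
  proof (induction ps rule: rev_nonempty_induct)
    case (snoc r ps)
    have IH: "last (hd ps @ concat (map tl (tl ps))) = last (last ps)"
      using snoc.prems snoc.hyps
      by (intro snoc.IH) (auto simp: nth_append split: if_splits dest: less_SucI)
    have "last (last ps) = hd r"
      using snoc.prems(2)[rule_format, of "length ps - 1"] snoc.hyps
      by (simp add: nth_append last_conv_nth)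
    moreover have "hd ps \<noteq> []" using snoc.prems snoc.hyps by simp
    ultimately show ?case using IH snoc by (cases r; cases "tl r = []") auto
  qed simp
  have ps: "ps \<noteq> []" "\<forall>r\<in>set ps. r \<noteq> []"
    "\<forall>i. Suc i < length ps \<longrightarrow> last (ps ! i) = hd (ps ! Suc i)"
    "p = hd ps @ concat (map tl (tl ps))"
    using assms(1) by (simp_all add: path_partition_def)
  have joint: "last (last ps) = hd r" using last[OF ps(1-3)] ps(4) assms(3) by simp
  have "last ((ps @ [r]) ! i) = hd ((ps @ [r]) ! Suc i)" if "Suc i < length (ps @ [r])" for i
  proof (cases "Suc i = length ps")
    case True
    then have "i = length ps - 1" by simp
    then have "ps ! i = last ps" using ps(1) by (simp add: last_conv_nth)
    then show ?thesis using True joint by (simp add: nth_append)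
  next
    case False
    then show ?thesis using that ps(3) by (simp add: nth_append)
  qed
  moreover have "p @ tl r = hd (ps @ [r]) @ concat (map tl (tl (ps @ [r])))"
    using ps(1,4) by simp
  ultimately show ?thesis using ps(2) assms(2) unfolding path_partition_def by simp
qed

text \<open>The first disjunct covers the time before any piece is finished, as
  \<open>path_partition\<close> excludes the empty list.\<close>

lemma path_partition_subpath:
  assumes "ps = [] \<and> a = 0 \<or> path_partition (take (Suc a) p) ps" "a \<le> b" "b < length p"
  shows "path_partition (take (Suc b) p) (ps @ [subpath p a b])"
  using assms(1)
proof
  assume "ps = [] \<and> a = 0"
  then show ?thesis using assms by (auto simp: path_partition_def subpath_def)
next
  assume *: "path_partition (take (Suc a) p) ps"
  have "last (take (Suc a) p) = p ! a"
    using assms by (simp add: take_Suc_conv_app_nth)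
  moreover have "tl (subpath p a b) = take (b - a) (drop (Suc a) p)"
    using assms(2) by (simp add: subpath_def tl_take tl_drop Suc_diff_le drop_Suc)
  moreover have "take (Suc a) p @ take (b - a) (drop (Suc a) p) = take (Suc b) p"
    using assms(2) take_add[of "Suc a" "b - a" p] by simp
  ultimately show ?thesis
    using path_partition_snoc[OF *, of "subpath p a b"] assms(2,3)
    by (simp add: hd_subpath subpath_neq_Nil)
qed

section \<open>Timed weakest preconditions\<close>

text \<open>Total correctness, with the cost handed to the postcondition. One halting run is enough,
  as \<open>computes_in\<close> asks for no more.\<close>

definition wp :: "com \<Rightarrow> state \<Rightarrow> (nat \<Rightarrow> state \<Rightarrow> bool) \<Rightarrow> bool" where
  "wp c s Q \<longleftrightarrow> (\<exists>t s'. exec c s t s' \<and> Q t s')"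

inductive_cases exec_cases:
  "exec Skip s t s'" "exec (Assign x e) s t s'" "exec (Store a i e) s t s'"
  "exec (Seq c1 c2) s t s'" "exec (Cond b c1 c2) s t s'"

lemmas exec_intros = exec.intros[simplified]

lemma wp_Skip [simp]: "wp Skip s Q \<longleftrightarrow> Q 1 s"
  unfolding wp_def by (auto intro: exec_intros elim!: exec_cases)

lemma wp_Assign [simp]:
  "wp (Assign x e) s Q \<longleftrightarrow> Q (acost e + 1) (s\<lparr>scalar := (scalar s)(x := aval e s)\<rparr>)"
  unfolding wp_def by (auto intro: exec_intros elim!: exec_cases)

lemma wp_Store [simp]:
  "wp (Store a i e) s Q \<longleftrightarrow> Q (acost i + acost e + 1)
     (s\<lparr>arr := (arr s)(a := (arr s a)(aval i s := aval e s))\<rparr>)"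
  unfolding wp_def by (auto intro: exec_intros elim!: exec_cases)

lemma wp_Seq [simp]:
  "wp (Seq c1 c2) s Q \<longleftrightarrow> wp c1 s (\<lambda>t1 s1. wp c2 s1 (\<lambda>t2 s2. Q (t1 + t2) s2))"
  unfolding wp_def by (safe elim!: exec_cases) (blast intro: exec.intros)+

lemma wp_Cond [simp]:
  "wp (Cond b c1 c2) s Q \<longleftrightarrow>
     (if bval b s then wp c1 s (\<lambda>t. Q (bcost b + t + 1)) else wp c2 s (\<lambda>t. Q (bcost b + t + 1)))"
  unfolding wp_def by (cases "bval b s") (auto elim!: exec_cases, (blast intro: exec_intros)+)

lemma wp_mono: "wp c s Q \<Longrightarrow> (\<And>t s'. Q t s' \<Longrightarrow> Q' t s') \<Longrightarrow> wp c s Q'"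
  by (auto simp: wp_def)

section \<open>Variables that a program cannot change\<close>

fun scalars_written :: "com \<Rightarrow> vname set" where
  "scalars_written Skip = {}"
| "scalars_written (Assign x e) = {x}"
| "scalars_written (Store a i e) = {}"
| "scalars_written (Seq c1 c2) = scalars_written c1 \<union> scalars_written c2"
| "scalars_written (Cond b c1 c2) = scalars_written c1 \<union> scalars_written c2"
| "scalars_written (While b c) = scalars_written c"

fun arrays_written :: "com \<Rightarrow> vname set" where
  "arrays_written Skip = {}"
| "arrays_written (Assign x e) = {}"
| "arrays_written (Store a i e) = {a}"
| "arrays_written (Seq c1 c2) = arrays_written c1 \<union> arrays_written c2"
| "arrays_written (Cond b c1 c2) = arrays_written c1 \<union> arrays_written c2"
| "arrays_written (While b c) = arrays_written c"

definition frame :: "com \<Rightarrow> state \<Rightarrow> state \<Rightarrow> bool" where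
  "frame c s s' \<longleftrightarrow> (\<forall>x. x \<notin> scalars_written c \<longrightarrow> scalar s' x = scalar s x)
     \<and> (\<forall>a. a \<notin> arrays_written c \<longrightarrow> arr s' a = arr s a)"

lemma frame_refl: "frame c s s"
  by (simp add: frame_def)

lemma exec_frame: "exec c s t s' \<Longrightarrow> frame c s s'"
  by (induction rule: exec.induct) (auto simp: frame_def)

lemma wp_frame: "wp c s Q \<Longrightarrow> wp c s (\<lambda>t s'. Q t s' \<and> frame c s s')"
  unfolding wp_def using exec_frame by blast

text \<open>The loop makes exactly \<open>n\<close> rounds, and the invariant is indexed by the
  rounds already made. The frame relates each intermediate state to the entry state, so an invariant
  need only mention what the body writes. The last summand of the bound is the failing test.\<close>

lemma wp_while:
  assumes init: "I 0 s0"
    and step: "\<And>i s. i < n \<Longrightarrow> I i s \<Longrightarrow> frame c s0 s \<Longrightarrow>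
      bval b s \<and> wp c s (\<lambda>t s'. t \<le> T \<and> I (Suc i) s')"
    and exit: "\<And>s. I n s \<Longrightarrow> frame c s0 s \<Longrightarrow> \<not> bval b s"
  shows "wp (While b c) s0 (\<lambda>t s'. t \<le> n * (T + bcost b + 1) + bcost b + 1 \<and> I n s' \<and> frame c s0 s')"
proof -
  \<comment> \<open>Here \<open>j\<close> is the number of rounds still to come.\<close>
  have "wp (While b c) s (\<lambda>t s'. t \<le> j * (T + bcost b + 1) + bcost b + 1 \<and> I n s' \<and> frame c s0 s')"
    if "I (n - j) s" "frame c s0 s" "j \<le> n" for j s
    using that
  proof (induction j arbitrary: s)
    case 0
    then show ?case using exit exec.WhileFalse unfolding wp_def by fastforce
  next
    case (Suc j)
    from step[of "n - Suc j" s] Suc.prems obtain t1 s1 where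
      1: "bval b s" "exec c s t1 s1" "t1 \<le> T" "I (n - j) s1"
      by (auto simp: wp_def Suc_diff_Suc)
    have "frame c s0 s1" using Suc.prems(2) exec_frame[OF 1(2)] by (simp add: frame_def)
    from Suc.IH[OF 1(4) this] Suc.prems(3) obtain t2 s2 where
      2: "exec (While b c) s1 t2 s2" "t2 \<le> j * (T + bcost b + 1) + bcost b + 1" "I n s2" "frame c s0 s2"
      by (auto simp: wp_def)
    have "bcost b + t1 + t2 + 1 \<le> Suc j * (T + bcost b + 1) + bcost b + 1"
      using 1(3) 2(2) by simp
    then show ?case using exec.WhileTrue[OF 1(1,2) 2(1)] 2(3,4) unfolding wp_def by blast
  qed
  from this[of n s0] init show ?thesis by (simp add: frame_refl)
qed

section \<open>The subroutines\<close>

notation Seq (infixr ";;" 60)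

text \<open>The graph without its faults is never built: each edge is looked up in the fault list.
  Both orientations are tried because the two lists may orient an edge differently. The disjunction
  is spelt by De Morgan.\<close>

definition scan_faults :: com where
  "scan_faults =
     Assign ''g'' (Const 0);;
     Assign ''x'' (Var ''FB'');;
     While (Less (Var ''x'') (Var ''FE''))
       (Cond (Neg (Conj
            (Neg (Conj (Equal (Elem ''input'' (Var ''x'')) (Var ''u''))
              (Equal (Elem ''input'' (Add (Var ''x'') (Const 1))) (Var ''v''))))
            (Neg (Conj (Equal (Elem ''input'' (Var ''x'')) (Var ''v''))
              (Equal (Elem ''input'' (Add (Var ''x'') (Const 1))) (Var ''u''))))))
          (Assign ''g'' (Const 1)) Skip;;
        Assign ''x'' (Add (Var ''x'') (Const 2)))"

text \<open>At most one of the two tests can succeed. Success puts the larger budget at 2 or more,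
  so the truncated subtraction is exact.\<close>

definition relax_edge :: com where
  "relax_edge =
     Assign ''u'' (Elem ''input'' (Var ''i''));;
     Assign ''v'' (Elem ''input'' (Add (Var ''i'') (Const 1)));;
     scan_faults;;
     Cond (Equal (Var ''g'') (Const 0))
       (Cond (Less (Add (Elem ''bud'' (Var ''v'')) (Const 1)) (Elem ''bud'' (Var ''u'')))
          (Store ''bud'' (Var ''v'') (Sub (Elem ''bud'' (Var ''u'')) (Const 1)))
          (Cond (Less (Add (Elem ''bud'' (Var ''u'')) (Const 1)) (Elem ''bud'' (Var ''v'')))
             (Store ''bud'' (Var ''u'') (Sub (Elem ''bud'' (Var ''v'')) (Const 1)))
             Skip))
       Skip;;
     Assign ''i'' (Add (Var ''i'') (Const 2))"

definition relax_all :: com where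
  "relax_all = Assign ''i'' (Const 2);; While (Less (Var ''i'') (Var ''EN'')) relax_edge"

text \<open>
  \<open>bud\<close> holds the steps that remain when a vertex is reached: it starts as the radius at the
  centre and drops by one per edge, so the open ball is where it is positive. In particular radius
  0 gives the empty ball.
\<close>

definition mark_ball :: com where
  "mark_ball =
     Assign ''i'' (Const 0);;
     While (Less (Var ''i'') (Elem ''input'' (Const 0)))
       (Store ''bud'' (Var ''i'') (Const 0);; Assign ''i'' (Add (Var ''i'') (Const 1)));;
     Store ''bud'' (Var ''c'') (Var ''rad'');;
     Assign ''r'' (Const 0);;
     While (Less (Var ''r'') (Var ''rad''))
       (relax_all;; Assign ''r'' (Add (Var ''r'') (Const 1)))"

text \<open>\<open>lo\<close> and \<open>hi\<close> are addresses in \<open>input\<close>, not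
  positions on the path. \<open>w\<close> is left alone and only \<open>pos\<close> moves, so the
  caller decides whether the part is kept.\<close>

definition write_path :: com where
  "write_path =
     Store ''output'' (Var ''w'') (Sub (Add (Var ''hi'') (Const 1)) (Var ''lo''));;
     Assign ''pos'' (Add (Var ''w'') (Const 1));;
     Assign ''i'' (Var ''lo'');;
     While (Less (Var ''i'') (Add (Var ''hi'') (Const 1)))
       (Store ''output'' (Var ''pos'') (Elem ''input'' (Var ''i''));;
        Assign ''pos'' (Add (Var ''pos'') (Const 1));;
        Assign ''i'' (Add (Var ''i'') (Const 1)))"

text \<open>Cell \<open>cp\<close> is reserved for the number of faults, which is known only after
  the scan. The sum of two budgets is positive iff one of them is.\<close>

definition write_faults :: com where
  "write_faults =
     Assign ''cp'' (Var ''pos'');;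
     Assign ''pos'' (Add (Var ''pos'') (Const 1));;
     Assign ''cnt'' (Const 0);;
     Assign ''x'' (Var ''FB'');;
     While (Less (Var ''x'') (Var ''FE''))
       (Assign ''u'' (Elem ''input'' (Var ''x''));;
        Assign ''v'' (Elem ''input'' (Add (Var ''x'') (Const 1)));;
        Cond (Less (Const 0) (Add (Elem ''bud'' (Var ''u'')) (Elem ''bud'' (Var ''v''))))
          (Store ''output'' (Var ''pos'') (Var ''u'');;
           Store ''output'' (Add (Var ''pos'') (Const 1)) (Var ''v'');;
           Assign ''pos'' (Add (Var ''pos'') (Const 2));;
           Assign ''cnt'' (Add (Var ''cnt'') (Const 1)))
          Skip;;
        Assign ''x'' (Add (Var ''x'') (Const 2)));;
     Store ''output'' (Var ''cp'') (Var ''cnt'')"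

definition emit :: com where
  "emit = mark_ball;; write_path;; write_faults"

text \<open>Turns the input word into facts about addresses, so that the programs are verified
  without unfolding the encoding; \<open>fault_instance_enc_input\<close> justifies these
  facts.\<close>

locale fault_instance =
  fixes n :: nat and E F :: "nat set set" and p :: "nat list" and k :: nat
    and es fs :: "(nat \<times> nat) list" and inp :: "nat \<Rightarrow> nat"
  assumes G: "ugraph {..<n} E" and F: "F \<subseteq> E" and p: "shortest_path {..<n} (E - F) p"
    and k: "1 \<le> k" and es: "lists_edges es E" and fs: "lists_edges fs F"
    and inp_n: "inp 0 = n"
    and inp_es_len: "inp 1 = length es"
    and inp_es: "\<And>i. i < length es \<Longrightarrow> inp (2 + 2 * i) = fst (es ! i) \<and> inp (2 + 2 * i + 1) = snd (es ! i)"
    and inp_fs_len: "inp (2 + 2 * length es) = length fs"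
    and inp_fs: "\<And>i. i < length fs \<Longrightarrow> inp (3 + 2 * length es + 2 * i) = fst (fs ! i)
      \<and> inp (3 + 2 * length es + 2 * i + 1) = snd (fs ! i)"
    and inp_p_len: "inp (3 + 2 * length es + 2 * length fs) = length p"
    and inp_p: "\<And>i. i < length p \<Longrightarrow> inp (4 + 2 * length es + 2 * length fs + i) = p ! i"
    and inp_k: "inp (4 + 2 * length es + 2 * length fs + length p) = k"
begin

abbreviation "PB \<equiv> 4 + 2 * length es + 2 * length fs"

text \<open>\<open>EN\<close>, \<open>FE\<close> and \<open>PE\<close> point just behind the edges,
  the faults and the path; the cells there hold the number of faults, the length of the path and
  \<open>k\<close>. \<open>PB\<close> is the address of the first vertex of the path.\<close>

definition parsed :: "state \<Rightarrow> bool" where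
  "parsed s \<longleftrightarrow> arr s ''input'' = inp \<and> scalar s ''EN'' = 2 + 2 * length es
     \<and> scalar s ''FB'' = 3 + 2 * length es \<and> scalar s ''FE'' = 3 + 2 * length es + 2 * length fs
     \<and> scalar s ''PE'' = PB + length p \<and> scalar s ''B'' = length fs div k"

lemma edge_bounds: "{u, v} \<in> E \<Longrightarrow> u < n \<and> v < n \<and> u \<noteq> v"
  using G unfolding ugraph_def by (cases "u = v") auto

lemma es_mem: "i < length es \<Longrightarrow> {fst (es ! i), snd (es ! i)} \<in> E"
  using es nth_mem[of i es] unfolding lists_edges_def edge_set_def by (auto simp: split_beta)

lemma fs_mem: "{u, v} \<in> F \<longleftrightarrow> (\<exists>i<length fs. fs ! i = (u, v) \<or> fs ! i = (v, u))"
proof -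
  have "{u, v} \<in> F \<longleftrightarrow> (\<exists>e\<in>set fs. {u, v} = {fst e, snd e})"
    using fs by (auto simp: lists_edges_def edge_set_def split_beta)
  also have "\<dots> \<longleftrightarrow> (\<exists>e\<in>set fs. e = (u, v) \<or> e = (v, u))"
    by (intro bex_cong) (auto simp: doubleton_eq_iff prod_eq_iff)
  also have "\<dots> \<longleftrightarrow> (\<exists>i<length fs. fs ! i = (u, v) \<or> fs ! i = (v, u))"
    by (metis in_set_conv_nth)
  finally show ?thesis .
qed

text \<open>The constants in this and the later time bounds are rounded up generously; all that
  counts is a polynomial.\<close>

abbreviation "t_scan \<equiv> length fs * 50 + 20"

lemma wp_scan_faults:
  assumes "parsed s"
  shows "wp scan_faults s (\<lambda>t s'. t \<le> t_scan \<and>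
     (scalar s' ''g'' = 0 \<longleftrightarrow> {scalar s ''u'', scalar s ''v''} \<notin> F) \<and> frame scan_faults s s')"
proof -
  let ?hit = "\<lambda>i. fs ! i = (scalar s ''u'', scalar s ''v'') \<or> fs ! i = (scalar s ''v'', scalar s ''u'')"
  define missed where "missed j \<longleftrightarrow> (\<forall>i<j. \<not> ?hit i)" for j
  have missed: "missed 0" "missed (Suc j) \<longleftrightarrow> missed j \<and> \<not> ?hit j" for j
    by (auto simp: missed_def less_Suc_eq)
  define I where "I j s' \<longleftrightarrow> scalar s' ''x'' = 3 + 2 * length es + 2 * j \<and>
     (scalar s' ''g'' = 0 \<longleftrightarrow> missed j)" for j and s' :: state
  have "wp scan_faults s (\<lambda>t s'. t \<le> t_scan \<and>
     (scalar s' ''g'' = 0 \<longleftrightarrow> {scalar s ''u'', scalar s ''v''} \<notin> F))"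
    unfolding scan_faults_def wp_Seq wp_Assign
    apply (rule wp_mono[OF wp_while[where I = I and n = "length fs" and T = 40]])
    subgoal using assms by (simp add: I_def parsed_def missed)
    subgoal premises prems for i s'
    proof -
      have eqs: "arr s' ''input'' = inp" "scalar s' ''x'' = 3 + 2 * length es + 2 * i"
        "scalar s' ''u'' = scalar s ''u''" "scalar s' ''v'' = scalar s ''v''"
        "scalar s' ''FE'' = 3 + 2 * length es + 2 * length fs"
        using assms prems(2,3) by (simp_all add: I_def parsed_def frame_def)
      have addr: "inp (3 + 2 * length es + 2 * i) = fst (fs ! i)"
        "inp (3 + 2 * length es + 2 * i + 1) = snd (fs ! i)"
        using inp_fs[OF prems(1)] by simp_all
      show ?thesis using prems(1,2) addr
        by (auto simp: eqs I_def prod_eq_iff missed)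
    qed
    subgoal using assms by (simp add: I_def parsed_def frame_def)
    subgoal by (simp add: I_def fs_mem missed_def)
    done
  from wp_frame[OF this] show ?thesis by (rule wp_mono) auto
qed

text \<open>One half of the invariant of \<open>mark_ball\<close>: a positive budget is backed by an
  actual walk, so none is too large. The other half, that none is too small, is in \<open>J\<close>
  of \<open>wp_mark_ball\<close>.\<close>

definition sound :: "nat \<Rightarrow> nat \<Rightarrow> (nat \<Rightarrow> nat) \<Rightarrow> bool" where
  "sound c R b \<longleftrightarrow> (\<forall>v<n. 0 < b v \<longrightarrow> (\<exists>l. l + b v \<le> R \<and> (c, v) \<in> adj (E - F) ^^ l))"

lemma sound_relax:
  assumes "sound c R b" "{u, v} \<in> E - F" "b v + 1 < b u"
  shows "sound c R (b(v := b u - 1))"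
proof -
  have "u < n" using assms(2) edge_bounds by blast
  then obtain l where "l + b u \<le> R" "(c, u) \<in> adj (E - F) ^^ l"
    using assms(1,3) unfolding sound_def by fastforce
  moreover have "(u, v) \<in> adj (E - F)" using assms(2) by (simp add: adj_def)
  ultimately have "Suc l + (b u - 1) \<le> R \<and> (c, v) \<in> adj (E - F) ^^ Suc l"
    using assms(3) by auto
  then show ?thesis using assms(1) unfolding sound_def by (metis fun_upd_apply)
qed

abbreviation "t_relax \<equiv> t_scan + 60"

text \<open>The left sides use the budgets from before the round. Later edges of the same round may
  raise a budget again and spoil the inequality between new budgets, but growth of \<open>b\<close>
  alone preserves this one.\<close>

definition relaxed :: "(nat \<Rightarrow> nat) \<Rightarrow> (nat \<Rightarrow> nat) \<Rightarrow> nat \<Rightarrow> nat \<Rightarrow> bool" where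
  "relaxed b0 b u v \<longleftrightarrow> b0 u \<le> b v + 1 \<and> b0 v \<le> b u + 1"

lemma wp_relax_edge:
  assumes "parsed s" "i < length es" "scalar s ''i'' = 2 + 2 * i" "sound c R (arr s ''bud'')"
  shows "wp relax_edge s (\<lambda>t s'. t \<le> t_relax \<and> scalar s' ''i'' = 4 + 2 * i \<and>
     sound c R (arr s' ''bud'') \<and> (\<forall>v. arr s ''bud'' v \<le> arr s' ''bud'' v) \<and>
     ({fst (es ! i), snd (es ! i)} \<in> E - F \<longrightarrow>
        relaxed (arr s' ''bud'') (arr s' ''bud'') (fst (es ! i)) (snd (es ! i))))"
proof -
  obtain u v where uv: "es ! i = (u, v)" by (cases "es ! i")
  have inp: "inp (2 + 2 * i) = u" "inp (2 + 2 * i + 1) = v" using inp_es[OF assms(2)] uv by auto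
  have E: "{u, v} \<in> E" using es_mem[OF assms(2)] uv by simp
  \<comment> \<open>Without this, lowering one budget by 1 would overwrite the budget it was derived
    from.\<close>
  have ne: "u \<noteq> v" using edge_bounds[OF E] by simp
  show ?thesis
    unfolding relax_edge_def wp_Seq[of "Assign _ _"] wp_Assign wp_Seq[of scan_faults]
    apply (rule wp_mono[OF wp_scan_faults])
    subgoal using assms(1) by (simp add: parsed_def)
    subgoal premises prems for t s'
    proof -
      have input: "arr s ''input'' = inp" using assms(1) by (simp add: parsed_def)
      have eqs: "scalar s' ''u'' = u" "scalar s' ''v'' = v" "scalar s' ''i'' = 2 + 2 * i"
        "arr s' ''bud'' = arr s ''bud''"
        using prems inp assms(3)
        by (simp_all add: frame_def scan_faults_def input)
      have g: "scalar s' ''g'' = 0 \<longleftrightarrow> {u, v} \<notin> F"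
        using prems inp assms(3) by (simp add: input)
      show ?thesis
      proof (cases "{u, v} \<in> F")
        case True
        then show ?thesis using prems g assms(4) by (simp add: eqs uv)
      next
        case False
        then have H: "{u, v} \<in> E - F" "{v, u} \<in> E - F" using E by (simp_all add: insert_commute)
        show ?thesis
          using prems g False ne assms(4) sound_relax[OF assms(4) H(1)] sound_relax[OF assms(4) H(2)]
          by (auto simp: eqs uv relaxed_def)
      qed
    qed
    done
qed


abbreviation "t_round \<equiv> length es * (t_relax + 10) + 20"

lemma wp_relax_all:
  assumes "parsed s" "sound c R (arr s ''bud'')"
  shows "wp relax_all s (\<lambda>t s'. t \<le> t_round \<and> sound c R (arr s' ''bud'') \<and>
     (\<forall>v. arr s ''bud'' v \<le> arr s' ''bud'' v) \<and>
     (\<forall>u v. {u, v} \<in> E - F \<longrightarrow> relaxed (arr s ''bud'') (arr s' ''bud'') u v) \<and>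
     frame relax_all s s')"
proof -
  define I where "I j s' \<longleftrightarrow> scalar s' ''i'' = 2 + 2 * j \<and> sound c R (arr s' ''bud'') \<and>
     (\<forall>v. arr s ''bud'' v \<le> arr s' ''bud'' v) \<and>
     (\<forall>i<j. {fst (es ! i), snd (es ! i)} \<in> E - F \<longrightarrow>
        relaxed (arr s ''bud'') (arr s' ''bud'') (fst (es ! i)) (snd (es ! i)))" for j and s' :: state
  have step: "I (Suc i) s2"
    if I: "I i s1" and i: "scalar s2 ''i'' = 4 + 2 * i" and sound: "sound c R (arr s2 ''bud'')"
      and mono: "\<forall>v. arr s1 ''bud'' v \<le> arr s2 ''bud'' v"
      and relaxed: "{fst (es ! i), snd (es ! i)} \<in> E - F \<longrightarrow>
        relaxed (arr s2 ''bud'') (arr s2 ''bud'') (fst (es ! i)) (snd (es ! i))" for i s1 s2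
  proof -
    have le: "arr s ''bud'' v \<le> arr s2 ''bud'' v" for v
      using I mono le_trans unfolding I_def by blast
    have "relaxed (arr s ''bud'') (arr s2 ''bud'') (fst (es ! j)) (snd (es ! j))"
      if "j < Suc i" "{fst (es ! j), snd (es ! j)} \<in> E - F" for j
    proof (cases "j = i")
      case True
      then show ?thesis
        using relaxed that(2) le[of "fst (es ! i)"] le[of "snd (es ! i)"] by (simp add: relaxed_def)
    next
      case False
      then have "relaxed (arr s ''bud'') (arr s1 ''bud'') (fst (es ! j)) (snd (es ! j))"
        using I that by (simp add: I_def)
      then show ?thesis
        using mono[rule_format, of "fst (es ! j)"] mono[rule_format, of "snd (es ! j)"]
        by (simp add: relaxed_def)
    qed
    then show ?thesis using i sound le by (simp add: I_def)
  qed
  have "wp relax_all s (\<lambda>t s'. t \<le> t_round \<and> I (length es) s')"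
    unfolding relax_all_def wp_Seq wp_Assign
    apply (rule wp_mono[OF wp_while[where I = I and n = "length es" and T = t_relax]])
    subgoal using assms by (simp add: I_def)
    subgoal premises prems for i s'
    proof
      have s': "parsed s'"
        using prems(3) assms(1)
        by (simp add: parsed_def frame_def relax_edge_def scan_faults_def)
      show "bval (Less (Var ''i'') (Var ''EN'')) s'"
        using prems(1,2) s' by (simp add: I_def parsed_def)
      show "wp relax_edge s' (\<lambda>t s'. t \<le> t_relax \<and> I (Suc i) s')"
        by (rule wp_mono[OF wp_relax_edge[OF s' prems(1), of c R]])
          (use prems(2) step[OF prems(2)] in \<open>auto simp: I_def\<close>)
    qed
    subgoal using assms by (simp add: I_def parsed_def frame_def relax_edge_def scan_faults_def)
    subgoal by (auto simp: algebra_simps)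
    done
  from wp_frame[OF this] show ?thesis
  proof (rule wp_mono, elim conjE, intro conjI)
    fix t s' assume I: "I (length es) s'"
    show "\<forall>u v. {u, v} \<in> E - F \<longrightarrow> relaxed (arr s ''bud'') (arr s' ''bud'') u v"
    proof (intro allI impI)
      fix u v assume uv: "{u, v} \<in> E - F"
      then have "{u, v} \<in> (\<lambda>(u, v). {u, v}) ` set es"
        using es by (auto simp: lists_edges_def edge_set_def)
      then obtain i where "i < length es" "{u, v} = {fst (es ! i), snd (es ! i)}"
        by (auto simp: in_set_conv_nth split_beta)
      then have "relaxed (arr s ''bud'') (arr s' ''bud'') (fst (es ! i)) (snd (es ! i))"
        using I uv by (simp add: I_def)
      then show "relaxed (arr s ''bud'') (arr s' ''bud'') u v"
        using \<open>{u, v} = _\<close> by (auto simp: relaxed_def doubleton_eq_iff)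
    qed
  qed (auto simp: I_def)
qed

abbreviation "t_ball R \<equiv> n * 20 + R * (t_round + 20) + 40"

lemma wp_mark_ball:
  assumes "parsed s" "scalar s ''c'' < n"
  shows "wp mark_ball s (\<lambda>t s'. t \<le> t_ball (scalar s ''rad'') \<and>
     (\<forall>v<n. 0 < arr s' ''bud'' v \<longleftrightarrow> v \<in> ball (E - F) (scalar s ''c'') (scalar s ''rad'')) \<and>
     frame mark_ball s s')"
proof -
  define c where "c = scalar s ''c''"
  define R where "R = scalar s ''rad''"
  define I where "I i s' \<longleftrightarrow> scalar s' ''i'' = i \<and> (\<forall>v<i. arr s' ''bud'' v = 0)" for i and s' :: state
  \<comment> \<open>As in Bellman-Ford, \<open>r\<close> rounds have followed all walks of at most
    \<open>r\<close> steps. A round may get further, depending on the order of the edges, and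
    \<open>sound\<close> keeps the budgets truthful then.\<close>
  define J where "J r s' \<longleftrightarrow> scalar s' ''r'' = r \<and> sound c R (arr s' ''bud'') \<and>
     (\<forall>v l. l \<le> r \<longrightarrow> (c, v) \<in> adj (E - F) ^^ l \<longrightarrow> R \<le> arr s' ''bud'' v + l)" for r and s' :: state
  have "wp mark_ball s (\<lambda>t s'. t \<le> t_ball R \<and> J R s')"
    unfolding mark_ball_def wp_Seq[of "Assign ''i'' _"] wp_Seq[of "Store ''bud'' _ _"]
      wp_Seq[of "While _ _"] wp_Seq[of "Assign ''r'' _"] wp_Assign wp_Store
    apply (rule wp_mono[OF wp_while[where I = I and n = n and T = 10]])
    subgoal by (simp add: I_def)
    subgoal for i s'
      using assms(1) inp_n by (auto simp: I_def parsed_def frame_def less_Suc_eq)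
    subgoal using assms(1) inp_n by (simp add: I_def parsed_def frame_def)
    subgoal premises prems for t1 s1
      apply (rule wp_mono[OF wp_while[where I = J and n = R and T = "t_round + 10"]])
      subgoal
        using prems assms(2)
        by (auto simp: J_def I_def frame_def c_def R_def sound_def)
      subgoal premises prems2 for r s2
      proof
        have s2: "parsed s2" "scalar s2 ''rad'' = R"
          using prems2(3) prems assms(1)
          by (simp_all add: parsed_def frame_def relax_all_def relax_edge_def scan_faults_def R_def)
        show "bval (Less (Var ''r'') (Var ''rad'')) s2"
          using prems2(1,2) s2 by (simp add: J_def)
        have sound: "sound c R (arr s2 ''bud'')" using prems2(2) by (simp add: J_def)
        show "wp (relax_all;; Assign ''r'' (Add (Var ''r'') (Const 1))) s2
            (\<lambda>t s'. t \<le> t_round + 10 \<and> J (Suc r) s')"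
          unfolding wp_Seq
        proof (rule wp_mono[OF wp_relax_all[OF s2(1) sound]], elim conjE)
          fix t3 s3
          assume t3: "t3 \<le> t_round" and sound3: "sound c R (arr s3 ''bud'')"
            and mono: "\<forall>v. arr s2 ''bud'' v \<le> arr s3 ''bud'' v"
            and relaxed: "\<forall>u v. {u, v} \<in> E - F \<longrightarrow> relaxed (arr s2 ''bud'') (arr s3 ''bud'') u v"
            and frame: "frame relax_all s2 s3"
          have "R \<le> arr s3 ''bud'' v + l" if "l \<le> Suc r" "(c, v) \<in> adj (E - F) ^^ l" for v l
          proof (cases "l \<le> r")
            case True
            then have "R \<le> arr s2 ''bud'' v + l" using prems2(2) that(2) by (simp add: J_def)
            then show ?thesis using mono[rule_format, of v] by simp
          next
            case False
            with that obtain u where u: "(c, u) \<in> adj (E - F) ^^ r" "{u, v} \<in> E - F" "l = Suc r"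
              by (auto simp: adj_def le_Suc_eq)
            then have "R \<le> arr s2 ''bud'' u + r" using prems2(2) by (simp add: J_def)
            then show ?thesis using relaxed[rule_format, OF u(2)] u(3) by (simp add: relaxed_def)
          qed
          moreover have "scalar s3 ''r'' = r"
            using frame prems2(2)
            by (simp add: frame_def J_def relax_all_def relax_edge_def scan_faults_def)
          ultimately show "wp (Assign ''r'' (Add (Var ''r'') (Const 1))) s3
            (\<lambda>t2 s'. t3 + t2 \<le> t_round + 10 \<and> J (Suc r) s')"
            using t3 sound3 by (simp add: J_def)
        qed
      qed
      subgoal using prems
        by (simp add: J_def frame_def relax_all_def relax_edge_def scan_faults_def R_def)
      subgoal using prems(1) by (simp add: algebra_simps)
      done
    done
  from wp_frame[OF this] show ?thesis
  proof (rule wp_mono, elim conjE, intro conjI)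
    fix t s' assume J: "J R s'"
    have "0 < arr s' ''bud'' v \<longleftrightarrow> v \<in> ball (E - F) c R" if v: "v < n" for v
    proof
      assume "0 < arr s' ''bud'' v"
      then obtain l where "l + arr s' ''bud'' v \<le> R" "(c, v) \<in> adj (E - F) ^^ l"
        using J v unfolding J_def sound_def by blast
      then show "v \<in> ball (E - F) c R"
        using \<open>0 < arr s' ''bud'' v\<close> unfolding ball_def by (intro CollectI exI[of _ l]) simp
    next
      assume "v \<in> ball (E - F) c R"
      then obtain l where "l < R" "(c, v) \<in> adj (E - F) ^^ l" by (auto simp: ball_def)
      then have "R \<le> arr s' ''bud'' v + l" using J by (simp add: J_def)
      then show "0 < arr s' ''bud'' v" using \<open>l < R\<close> by simp
    qed
    then show "\<forall>v<n. 0 < arr s' ''bud'' v \<longleftrightarrow> v \<in> ball (E - F) (scalar s ''c'') (scalar s ''rad'')"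
      by (simp add: c_def R_def)
  qed (auto simp: R_def)
qed

end

section \<open>Writing one part of the output\<close>

context fault_instance
begin

lemma subpath_eq_map:
  assumes "b < length p"
  shows "subpath p a b = map (\<lambda>i. p ! (a + i)) [0..<Suc b - a]"
  using assms by (intro nth_equalityI) (auto simp: subpath_def)

abbreviation "t_write_path m \<equiv> m * 30 + 30"

lemma wp_write_path:
  assumes "parsed s" "scalar s ''lo'' = PB + a" "scalar s ''hi'' = PB + b" "a \<le> b" "b < length p"
    and w: "w = scalar s ''w''"
  shows "wp write_path s (\<lambda>t s'. t \<le> t_write_path (Suc b - a) \<and>
     scalar s' ''pos'' = w + length (enc_path (subpath p a b)) \<and>
     map (arr s' ''output'') [w..<scalar s' ''pos''] = enc_path (subpath p a b) \<and>
     (\<forall>x<w. arr s' ''output'' x = arr s ''output'' x) \<and> frame write_path s s')"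
proof -
  define I where "I j s' \<longleftrightarrow> scalar s' ''i'' = PB + a + j \<and> scalar s' ''pos'' = Suc (w + j) \<and>
     arr s' ''output'' w = Suc b - a \<and>
     map (arr s' ''output'') [Suc w..<Suc (w + j)] = map (\<lambda>i. p ! (a + i)) [0..<j] \<and>
     (\<forall>x<w. arr s' ''output'' x = arr s ''output'' x)" for j and s' :: state
  have "wp write_path s (\<lambda>t s'. t \<le> t_write_path (Suc b - a) \<and> I (Suc b - a) s')"
    unfolding write_path_def wp_Seq[of "Assign _ _"] wp_Seq[of "Store _ _ _"] wp_Assign wp_Store
    apply (rule wp_mono[OF wp_while[where I = I and n = "Suc b - a" and T = 20]])
    subgoal using assms by (simp add: I_def)
    subgoal premises prems for j s'
    proof -
      have eqs: "arr s' ''input'' = inp" "scalar s' ''hi'' = PB + b"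
        using assms(1,3) prems(3) by (simp_all add: parsed_def frame_def)
      have p: "inp (PB + a + j) = p ! (a + j)"
        using inp_p[of "a + j"] prems(1) assms(4,5) by (simp add: add.assoc)
      show ?thesis using prems(1,2) assms(4) p by (simp add: I_def eqs)
    qed
    subgoal using assms by (simp add: I_def parsed_def frame_def)
    subgoal by simp
    done
  from wp_frame[OF this] show ?thesis
  proof (rule wp_mono, elim conjE, intro conjI)
    fix t s' assume I: "I (Suc b - a) s'"
    then show pos: "scalar s' ''pos'' = w + length (enc_path (subpath p a b))"
      using assms(4,5) by (simp add: I_def enc_path_def length_subpath)
    have "[w..<scalar s' ''pos''] = w # [Suc w..<Suc (w + (Suc b - a))]"
      using I by (simp add: I_def upt_conv_Cons del: upt_Suc)
    then show "map (arr s' ''output'') [w..<scalar s' ''pos''] = enc_path (subpath p a b)"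
      using I assms(4,5)
      by (simp add: I_def enc_path_def length_subpath flip: subpath_eq_map del: upt_Suc)
  qed (auto simp: I_def)
qed

abbreviation "t_write_faults \<equiv> length fs * 60 + 40"

lemma wp_write_faults:
  assumes "parsed s" and bud: "\<forall>v<n. 0 < arr s ''bud'' v \<longleftrightarrow> v \<in> ball (E - F) c r"
    and w: "w = scalar s ''pos''"
  shows "wp write_faults s (\<lambda>t s'. t \<le> t_write_faults \<and>
     scalar s' ''cnt'' = length (touching (E - F) fs c r) \<and>
     scalar s' ''pos'' = w + length (enc_edges (touching (E - F) fs c r)) \<and>
     map (arr s' ''output'') [w..<scalar s' ''pos''] = enc_edges (touching (E - F) fs c r) \<and>
     (\<forall>x<w. arr s' ''output'' x = arr s ''output'' x) \<and> frame write_faults s s')"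
proof -
  define T where "T j = touching (E - F) (take j fs) c r" for j
  define L where "L j = concat (map (\<lambda>(u, v). [u, v]) (T j))" for j
  have len: "length L' = 2 * length T'" if "L' = concat (map (\<lambda>(u, v). [u, v]) T')"
    for L' :: "nat list" and T' :: "(nat \<times> nat) list"
    using that by (induction T' arbitrary: L') auto
  define I where "I j s' \<longleftrightarrow> scalar s' ''x'' = 3 + 2 * length es + 2 * j \<and>
     scalar s' ''cp'' = w \<and> scalar s' ''cnt'' = length (T j) \<and>
     scalar s' ''pos'' = Suc (w + 2 * length (T j)) \<and>
     map (arr s' ''output'') [Suc w..<Suc (w + 2 * length (T j))] = L j \<and>
     (\<forall>x<w. arr s' ''output'' x = arr s ''output'' x)" for j and s' :: state
  have "wp write_faults s (\<lambda>t s'. t \<le> t_write_faults \<and> scalar s' ''cnt'' = length (T (length fs)) \<and>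
     scalar s' ''pos'' = Suc (w + 2 * length (T (length fs))) \<and>
     arr s' ''output'' w = length (T (length fs)) \<and>
     map (arr s' ''output'') [Suc w..<Suc (w + 2 * length (T (length fs)))] = L (length fs) \<and>
     (\<forall>x<w. arr s' ''output'' x = arr s ''output'' x))"
    unfolding write_faults_def wp_Seq[of "Assign _ _"] wp_Seq[of "While _ _"] wp_Assign
    apply (rule wp_mono[OF wp_while[where I = I and n = "length fs" and T = 50]])
    subgoal using assms by (simp add: I_def parsed_def T_def L_def touching_def)
    subgoal premises prems for j s'
    proof -
      obtain u v where uv: "fs ! j = (u, v)" by (cases "fs ! j")
      \<comment> \<open>The budgets are specified only for vertices below \<open>n\<close>, so the
        ends of the fault must be bounded through the graph.\<close>
      have "{u, v} \<in> F" using fs_mem uv prems(1) by blast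
      then have "u < n" "v < n" using edge_bounds F by blast+
      moreover have eqs: "arr s' ''input'' = inp" "scalar s' ''x'' = 3 + 2 * length es + 2 * j"
        "scalar s' ''FE'' = 3 + 2 * length es + 2 * length fs" "arr s' ''bud'' = arr s ''bud''"
        using assms(1) prems(2,3) by (simp_all add: I_def parsed_def frame_def)
      ultimately have hit: "0 < arr s ''bud'' u + arr s ''bud'' v \<longleftrightarrow>
          u \<in> ball (E - F) c r \<or> v \<in> ball (E - F) c r"
        using bud by auto
      have T: "T (Suc j) = T j @ (if 0 < arr s ''bud'' u + arr s ''bud'' v then [(u, v)] else [])"
        unfolding hit using prems(1) uv by (simp add: T_def touching_def take_Suc_conv_app_nth)
      have addr: "inp (3 + 2 * length es + 2 * j) = u" "inp (3 + 2 * length es + 2 * j + 1) = v"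
        using inp_fs[OF prems(1)] uv by simp_all
      show ?thesis
      proof (cases "0 < arr s ''bud'' u + arr s ''bud'' v")
        case True
        then have "T (Suc j) = T j @ [(u, v)]" "L (Suc j) = L j @ [u, v]"
          using T by (simp_all add: L_def)
        then show ?thesis using prems(1,2) addr True by (simp add: I_def eqs)
      next
        case False
        then have "T (Suc j) = T j" "L (Suc j) = L j"
          using T by (simp_all add: L_def)
        then show ?thesis using prems(1,2) addr False by (simp add: I_def eqs)
      qed
    qed
    subgoal using assms by (simp add: I_def parsed_def frame_def)
    subgoal by (simp add: I_def del: upt_Suc)
    done
  from wp_frame[OF this] show ?thesis
  proof (rule wp_mono, elim conjE, intro conjI)
    have T: "T (length fs) = touching (E - F) fs c r" by (simp add: T_def)
    fix t s'
    assume *: "scalar s' ''cnt'' = length (T (length fs))"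
      "scalar s' ''pos'' = Suc (w + 2 * length (T (length fs)))"
      "arr s' ''output'' w = length (T (length fs))"
      "map (arr s' ''output'') [Suc w..<Suc (w + 2 * length (T (length fs)))] = L (length fs)"
    show "scalar s' ''cnt'' = length (touching (E - F) fs c r)" using * T by simp
    show pos: "scalar s' ''pos'' = w + length (enc_edges (touching (E - F) fs c r))"
      using * T len[OF refl] by (simp add: enc_edges_def)
    have "[w..<scalar s' ''pos''] = w # [Suc w..<Suc (w + 2 * length (T (length fs)))]"
      using * by (simp add: upt_conv_Cons del: upt_Suc)
    then show "map (arr s' ''output'') [w..<scalar s' ''pos''] = enc_edges (touching (E - F) fs c r)"
      using * T by (simp add: enc_edges_def L_def del: upt_Suc)
  qed auto
qed

lemma length_p: "length p \<le> n"
proof -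
  have "card (set p) \<le> card {..<n}"
    using p unfolding shortest_path_def is_path_def by (intro card_mono) auto
  then show ?thesis using p by (simp add: shortest_path_def is_path_def distinct_card)
qed

definition enc_part :: "nat list \<times> (nat \<times> nat) list \<Rightarrow> nat list" where
  "enc_part part = enc_path (fst part) @ enc_edges (snd part)"

text \<open>The radius is separate from \<open>a\<close> and \<open>b\<close>: it is
  \<open>b - a\<close> for a greedy piece and 0 for a single edge, whose fault list is then
  empty.\<close>

definition part :: "nat \<Rightarrow> nat \<Rightarrow> nat \<Rightarrow> nat \<Rightarrow> nat list \<times> (nat \<times> nat) list" where
  "part a b c r = (subpath p a b, touching (E - F) fs c r)"

abbreviation "t_emit \<equiv> t_ball n + t_write_path n + t_write_faults"

text \<open>\<open>xs\<close> is the output settled so far; it starts at cell 1, as cell 0 will hold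
  the number of parts. Both the prefix up to \<open>pos\<close> and the one up to the old
  \<open>w\<close> are described, so that the caller may accept or discard the new part.\<close>

lemma wp_emit:
  assumes "parsed s" "scalar s ''lo'' = PB + a" "scalar s ''hi'' = PB + b" "a \<le> b" "b < length p"
    and c: "scalar s ''c'' = c" "c < n" and r: "scalar s ''rad'' = r" "r < n"
    and w: "scalar s ''w'' = Suc (length xs)" "map (arr s ''output'') [1..<Suc (length xs)] = xs"
  shows "wp emit s (\<lambda>t s'. t \<le> t_emit \<and>
     scalar s' ''cnt'' = length (snd (part a b c r)) \<and>
     scalar s' ''pos'' = Suc (length (xs @ enc_part (part a b c r))) \<and>
     map (arr s' ''output'') [1..<scalar s' ''pos''] = xs @ enc_part (part a b c r) \<and>
     map (arr s' ''output'') [1..<scalar s ''w''] = xs \<and>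
     frame emit s s')"
proof -
  have "wp emit s (\<lambda>t s'. t \<le> t_emit \<and>
     scalar s' ''cnt'' = length (snd (part a b c r)) \<and>
     scalar s' ''pos'' = Suc (length (xs @ enc_part (part a b c r))) \<and>
     map (arr s' ''output'') [1..<scalar s' ''pos''] = xs @ enc_part (part a b c r) \<and>
     map (arr s' ''output'') [1..<scalar s ''w''] = xs)"
    unfolding emit_def wp_Seq
  proof (rule wp_mono[OF wp_mark_ball[OF assms(1)]], goal_cases)
    case 1
    then show ?case using c by simp
  next
    case (2 t1 s1)
    then have t1: "t1 \<le> t_ball r" and frame1: "frame mark_ball s s1"
      and bud1: "\<forall>v<n. 0 < arr s1 ''bud'' v \<longleftrightarrow> v \<in> ball (E - F) c r"
      using c r by auto
    note frame1 = frame1[unfolded mark_ball_def relax_all_def relax_edge_def scan_faults_def frame_def, simplified]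
    have s1: "parsed s1" "scalar s1 ''lo'' = PB + a" "scalar s1 ''hi'' = PB + b"
      using frame1 assms(1-3) by (simp_all add: parsed_def)
    show ?case
    proof (rule wp_mono[OF wp_write_path[OF s1 assms(4,5) refl]], goal_cases)
      case (1 t2 s2)
      define w2 where "w2 = Suc (length xs)"
      have w2: "scalar s1 ''w'' = w2" using frame1 w(1) by (simp add: w2_def)
      have frame2: "frame write_path s1 s2" using 1 by blast
      note frame2 = frame2[unfolded write_path_def frame_def, simplified]
      have s2: "parsed s2" "\<forall>v<n. 0 < arr s2 ''bud'' v \<longleftrightarrow> v \<in> ball (E - F) c r"
        using frame2 s1 bud1 by (simp_all add: parsed_def)
      define x2 where "x2 = scalar s2 ''pos''"
      have x2: "x2 = w2 + length (enc_path (subpath p a b))"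
        "map (arr s2 ''output'') [w2..<x2] = enc_path (subpath p a b)"
        "\<forall>x<w2. arr s2 ''output'' x = arr s1 ''output'' x"
        using 1 unfolding x2_def w2 by blast+
      then have x2_s: "\<forall>x<w2. arr s2 ''output'' x = arr s ''output'' x"
        using frame1 by simp
      show ?case
      proof (rule wp_mono[OF wp_write_faults[OF s2 refl]], fold x2_def, goal_cases)
        case (1 t3 s3)
        define x3 where "x3 = scalar s3 ''pos''"
        have x3: "x3 = x2 + length (enc_edges (touching (E - F) fs c r))"
          "map (arr s3 ''output'') [x2..<x3] = enc_edges (touching (E - F) fs c r)"
          "\<forall>x<x2. arr s3 ''output'' x = arr s2 ''output'' x"
          using 1 unfolding x3_def by blast+
        have xs: "map (arr s3 ''output'') [1..<w2] = xs"
          using x2(1) x2_s x3(3) w(2) unfolding w2_def[symmetric]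
          by (metis (no_types, lifting) atLeastLessThan_iff map_cong set_upt trans_less_add1)
        moreover have "map (arr s3 ''output'') [w2..<x2] = enc_path (subpath p a b)"
          using x3(3) x2(2) by (metis (no_types, lifting) atLeastLessThan_iff map_cong set_upt)
        moreover have "[1..<x3] = [1..<w2] @ [w2..<x2] @ [x2..<x3]"
          using x2(1) x3(1) w2_def by (metis One_nat_def Suc_leI le_add1 upt_add_eq_append zero_less_Suc
              le_add_diff_inverse trans_le_add1 append.assoc)
        ultimately have out: "map (arr s3 ''output'') [1..<x3] = xs @ enc_part (part a b c r)"
          using x3(2) by (simp add: enc_part_def part_def)
        have pos: "x3 = Suc (length (xs @ enc_part (part a b c r)))"
          using x2(1) x3(1) by (simp add: w2_def enc_part_def part_def)
        have t: "t1 + (t2 + t3) \<le> t_emit"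
        proof -
          have "t_ball r \<le> t_ball n" using r by simp
          moreover have "t_write_path (Suc b - a) \<le> t_write_path n"
            using length_p assms(5) by simp
          ultimately show ?thesis using t1 1 \<open>t2 \<le> _ \<and> _\<close> by linarith
        qed
        show ?case
          using t 1 pos out xs w(1) unfolding x3_def[symmetric] by (simp add: part_def w2_def)
      qed
    qed
  qed
  from wp_frame[OF this] show ?thesis by (rule wp_mono) blast
qed

end

section \<open>The greedy decomposition\<close>

text \<open>The machine has no division; repeated subtraction takes \<open>length fs div k\<close>
  rounds, which is affordable because the running time may depend on the number of faults.\<close>

definition divide_faults :: com where
  "divide_faults =
     Assign ''B'' (Const 0);;
     Assign ''r'' (Elem ''input'' (Var ''EN''));;
     While (Neg (Less (Var ''r'') (Var ''k'')))
       (Assign ''r'' (Sub (Var ''r'') (Var ''k''));; Assign ''B'' (Add (Var ''B'') (Const 1)))"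

definition parse :: com where
  "parse =
     Assign ''EN'' (Add (Const 2) (Add (Elem ''input'' (Const 1)) (Elem ''input'' (Const 1))));;
     Assign ''FB'' (Add (Var ''EN'') (Const 1));;
     Assign ''FE'' (Add (Var ''FB'') (Add (Elem ''input'' (Var ''EN'')) (Elem ''input'' (Var ''EN''))));;
     Assign ''PE'' (Add (Add (Var ''FE'') (Const 1)) (Elem ''input'' (Var ''FE'')));;
     Assign ''k'' (Elem ''input'' (Var ''PE''));;
     divide_faults"

text \<open>The edge into \<open>j\<close> is emitted with radius 0, so its centre does not matter.
  \<open>N\<close> counts the open piece too: it grows by 2 because two pieces are closed and one
  stays open.\<close>

definition cut :: com where
  "cut =
     Assign ''lo'' (Var ''a'');;
     Assign ''hi'' (Sub (Var ''j'') (Const 1));;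
     Assign ''rad'' (Sub (Var ''hi'') (Var ''lo''));;
     Assign ''c'' (Var ''cg'');;
     emit;;
     Assign ''w'' (Var ''pos'');;
     Assign ''lo'' (Var ''hi'');;
     Assign ''hi'' (Var ''j'');;
     Assign ''rad'' (Const 0);;
     emit;;
     Assign ''w'' (Var ''pos'');;
     Assign ''a'' (Var ''j'');;
     Assign ''cg'' (Elem ''input'' (Var ''j''));;
     Assign ''N'' (Add (Var ''N'') (Const 2))"

text \<open>
  Both candidates are written at \<open>w\<close>, behind the finished part of the output, only in order to count
  their faults. They are overwritten later, which is why \<open>cut\<close> emits the last good piece again from
  its recorded centre \<open>cg\<close>.
\<close>

definition extend :: com where
  "extend =
     Assign ''lo'' (Var ''a'');;
     Assign ''hi'' (Var ''j'');;
     Assign ''rad'' (Sub (Var ''j'') (Var ''a''));;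
     Assign ''c'' (Elem ''input'' (Var ''a''));;
     emit;;
     Cond (Less (Var ''B'') (Var ''cnt''))
       (Assign ''c'' (Elem ''input'' (Var ''j''));;
        emit;;
        Cond (Less (Var ''B'') (Var ''cnt'')) cut (Assign ''cg'' (Var ''c'')))
       (Assign ''cg'' (Var ''c''));;
     Assign ''j'' (Add (Var ''j'') (Const 1))"

text \<open>The piece left open at the end of the path is good by the invariant, so it is emitted
  without a test.\<close>

definition decompose :: com where
  "decompose =
     parse;;
     Assign ''w'' (Const 1);;
     Assign ''N'' (Const 1);;
     Assign ''a'' (Add (Var ''FE'') (Const 1));;
     Assign ''cg'' (Elem ''input'' (Var ''a''));;
     Assign ''j'' (Add (Var ''a'') (Const 1));;
     While (Less (Var ''j'') (Var ''PE'')) extend;;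
     Assign ''lo'' (Var ''a'');;
     Assign ''hi'' (Sub (Var ''PE'') (Const 1));;
     Assign ''rad'' (Sub (Var ''hi'') (Var ''lo''));;
     Assign ''c'' (Var ''cg'');;
     emit;;
     Store ''output'' (Const 0) (Var ''N'');;
     Assign ''output'' (Var ''pos'')"

section \<open>The greedy process on the path\<close>

context fault_instance
begin

definition few :: "nat list \<times> (nat \<times> nat) list \<Rightarrow> bool" where
  "few x \<longleftrightarrow> length (snd x) \<le> length fs div k"

definition good_part :: "nat list \<times> (nat \<times> nat) list \<Rightarrow> bool" where
  "good_part x \<longleftrightarrow> edge_set (snd x) \<subseteq> F \<and> card (edge_set (snd x)) \<le> length fs div k
     \<and> shortest_path {..<n} (E - edge_set (snd x)) (fst x)"

lemma edge_set_part: "edge_set (snd (part a b c r)) = {e \<in> F. e \<inter> ball (E - F) c r \<noteq> {}}"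
  using fs by (simp add: part_def edge_set_touching lists_edges_def)

lemma good_partI:
  assumes "a \<le> b" "b < length p" "c = p ! a \<or> c = p ! b" "few (part a b c (b - a))"
  shows "good_part (part a b c (b - a))"
proof -
  have "card (edge_set (snd (part a b c (b - a)))) = length (snd (part a b c (b - a)))"
    unfolding edge_set_part by (simp add: part_def length_touching[OF fs])
  moreover have "shortest_path {..<n} (E - edge_set (snd (part a b c (b - a)))) (subpath p a b)"
    by (rule shortest_subpath[OF G p assms(1-3) edge_set_part])
  moreover have "fst (part a b c (b - a)) = subpath p a b" by (simp add: part_def)
  moreover have "edge_set (snd (part a b c (b - a))) \<subseteq> F" unfolding edge_set_part by blast
  ultimately show ?thesis
    using assms(4) by (simp add: good_part_def few_def)
qed

lemma touching_0: "touching H es' c 0 = []"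
  by (simp add: touching_def ball_def)

lemma good_part_edge:
  assumes "Suc a < length p"
  shows "good_part (part a (Suc a) c 0)"
proof -
  have "is_path {..<n} (E - F) p" using p by (simp add: shortest_path_def)
  then have "is_path {..<n} E p" by (rule is_path_mono) auto
  from shortest_subpath_edge[OF this assms] show ?thesis
    by (simp add: good_part_def part_def touching_0 edge_set_def)
qed

text \<open>
  \<open>D\<close> lists the finished pieces, \<open>bs\<close> the starts of all pieces so far other than the single edges,
  and \<open>a\<close>, \<open>c\<close>, \<open>j\<close> are the start, the centre and the end of the current piece.
\<close>

definition greedy :: "(nat list \<times> (nat \<times> nat) list) list \<Rightarrow> nat list \<Rightarrow> nat \<Rightarrow> nat \<Rightarrow> nat \<Rightarrow> bool" where
  "greedy D bs a c j \<longleftrightarrow> bs \<noteq> [] \<and> last bs = a \<and> sorted_wrt (<) bs \<and> (\<forall>b\<in>set bs. b < length p)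
     \<and> (\<forall>i c. Suc i < length bs \<longrightarrow> c = p ! (bs ! i) \<or> c = p ! (bs ! Suc i) \<longrightarrow>
          \<not> few (part (bs ! i) (bs ! Suc i) c (bs ! Suc i - bs ! i)))
     \<and> length D + 2 = 2 * length bs
     \<and> (D = [] \<and> a = 0 \<or> path_partition (take (Suc a) p) (map fst D))
     \<and> (\<forall>x\<in>set D. good_part x)
     \<and> a \<le> j \<and> j < length p \<and> (c = p ! a \<or> c = p ! j) \<and> few (part a j c (j - a))"

lemma p_neq_Nil: "p \<noteq> []"
  using p by (simp add: shortest_path_def is_path_def)

lemma p_nth: "i < length p \<Longrightarrow> p ! i < n"
  using p nth_mem unfolding shortest_path_def is_path_def by blast

lemma greedy_init: "greedy [] [0] 0 (p ! 0) 0"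
  using p_neq_Nil by (simp add: greedy_def few_def part_def touching_0)

lemma greedy_extend:
  assumes "greedy D bs a c j" "Suc j < length p" "c' = p ! a \<or> c' = p ! Suc j"
    "few (part a (Suc j) c' (Suc j - a))"
  shows "greedy D bs a c' (Suc j)"
  using assms unfolding greedy_def by auto

text \<open>The interval that failed and the pieces emitted differ: \<open>bs\<close> records the
  bad interval from \<open>a\<close> to \<open>Suc j\<close>, whereas \<open>D\<close> receives the
  good piece from \<open>a\<close> to \<open>j\<close> and the edge behind it.\<close>

lemma greedy_cut:
  assumes g: "greedy D bs a c j" and j: "Suc j < length p"
    and bad: "\<And>c. c = p ! a \<or> c = p ! Suc j \<Longrightarrow> \<not> few (part a (Suc j) c (Suc j - a))"
  shows "greedy (D @ [part a j c (j - a), part j (Suc j) c 0]) (bs @ [Suc j]) (Suc j) (p ! Suc j) (Suc j)"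
proof -
  have bs: "bs \<noteq> []" "last bs = a" "sorted_wrt (<) bs" and a: "a \<le> j"
    and good: "\<forall>x\<in>set D. good_part x" "c = p ! a \<or> c = p ! j" "few (part a j c (j - a))"
    and pp: "D = [] \<and> a = 0 \<or> path_partition (take (Suc a) p) (map fst D)"
    using g by (auto simp: greedy_def)
  have "b \<le> a" if "b \<in> set bs" for b
    using bs that by (cases bs rule: rev_cases) (auto simp: sorted_wrt_append less_imp_le)
  then have sorted: "sorted_wrt (<) (bs @ [Suc j])"
    using bs a by (force simp: sorted_wrt_append)
  have "path_partition (take (Suc j) p) (map fst (D @ [part a j c (j - a)]))"
    using path_partition_subpath[of "map fst D" a p j] pp a j by (simp add: part_def)
  then have pp': "path_partition (take (Suc (Suc j)) p) (map fst (D @ [part a j c (j - a), part j (Suc j) c 0]))"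
    using path_partition_subpath[of "map fst (D @ [part a j c (j - a)])" j p "Suc j"] j
    by (simp add: part_def)
  have bad': "\<not> few (part ((bs @ [Suc j]) ! i) ((bs @ [Suc j]) ! Suc i) c' ((bs @ [Suc j]) ! Suc i - (bs @ [Suc j]) ! i))"
    if i: "Suc i < length (bs @ [Suc j])"
      and c': "c' = p ! ((bs @ [Suc j]) ! i) \<or> c' = p ! ((bs @ [Suc j]) ! Suc i)" for i c'
  proof (cases "Suc i = length bs")
    case True
    then have "(bs @ [Suc j]) ! i = a" "(bs @ [Suc j]) ! Suc i = Suc j"
      using bs(1,2) by (auto simp: nth_append last_conv_nth simp flip: True)
    then show ?thesis using bad c' by simp
  next
    case False
    have "\<not> few (part (bs ! i) (bs ! Suc i) c' (bs ! Suc i - bs ! i))"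
      if "Suc i < length bs" "c' = p ! (bs ! i) \<or> c' = p ! (bs ! Suc i)"
      using g that unfolding greedy_def by blast
    then show ?thesis using False i c' by (simp add: nth_append)
  qed
  \<comment> \<open>The case \<open>j = a\<close> is possible: an interval of one edge may be bad,
    and the good piece before it is then a single vertex with radius 0.\<close>
  have "good_part (part a j c (j - a))" using good j a by (intro good_partI) auto
  then have good': "\<forall>x\<in>set (D @ [part a j c (j - a), part j (Suc j) c 0]). good_part x"
    using good(1) good_part_edge[OF j] by simp
  have "few (part (Suc j) (Suc j) (p ! Suc j) (Suc j - Suc j))"
    by (simp add: few_def part_def touching_0)
  then show ?thesis
    unfolding greedy_def using g j sorted pp' bad' good' unfolding greedy_def by simp
qed

lemma greedy_finish:
  assumes g: "greedy D bs a c j" and j: "Suc j = length p"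
  shows "path_partition p (map fst (D @ [part a j c (j - a)]))"
    and "\<forall>x\<in>set (D @ [part a j c (j - a)]). good_part x"
    and "length D \<le> 8 * k"
proof -
  show "path_partition p (map fst (D @ [part a j c (j - a)]))"
    using path_partition_subpath[of "map fst D" a p j] g j by (auto simp: greedy_def part_def)
  have "good_part (part a j c (j - a))" using g by (intro good_partI) (auto simp: greedy_def)
  then show "\<forall>x\<in>set (D @ [part a j c (j - a)]). good_part x"
    using g by (simp add: greedy_def)
  have "length bs \<le> 4 * k"
    using g by (intro few_bad_intervals[OF G F fs p _ _ _ k]) (auto simp: greedy_def few_def part_def not_le)
  \<comment> \<open>By \<open>greedy\<close>, every break point except the first accounts for two
    finished pieces.\<close>
  then show "length D \<le> 8 * k" using g by (simp add: greedy_def)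
qed

section \<open>Verification of the greedy program\<close>

abbreviation "t_div \<equiv> length fs div k * 20 + 20"

lemma wp_divide_faults:
  assumes "arr s ''input'' = inp" "scalar s ''EN'' = 2 + 2 * length es" "scalar s ''k'' = k"
  shows "wp divide_faults s (\<lambda>t s'. t \<le> t_div \<and> scalar s' ''B'' = length fs div k \<and> frame divide_faults s s')"
proof -
  define I where "I i s' \<longleftrightarrow> scalar s' ''B'' = i \<and> scalar s' ''r'' = length fs - i * k" for i and s' :: state
  have "wp divide_faults s (\<lambda>t s'. t \<le> t_div \<and> scalar s' ''B'' = length fs div k)"
    unfolding divide_faults_def wp_Seq wp_Assign
    apply (rule wp_mono[OF wp_while[where I = I and n = "length fs div k" and T = 10]])
    subgoal using assms inp_fs_len by (simp add: I_def)
    subgoal premises prems for i s'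
    proof -
      have "Suc i * k \<le> length fs div k * k" using prems(1) by (intro mult_right_mono) auto
      also have "\<dots> \<le> length fs" by simp
      finally have "Suc i * k \<le> length fs" .
      then show ?thesis
        using prems assms(3) by (auto simp: I_def frame_def add.commute)
    qed
    \<comment> \<open>Register \<open>r\<close> has come down to \<open>length fs mod k\<close>,
      which is below \<open>k\<close> because \<open>k\<close> is positive.\<close>
    subgoal for s'
      using assms(3) k mod_less_divisor[of k "length fs"]
      by (simp add: I_def frame_def minus_div_mult_eq_mod)
    subgoal by (auto simp: I_def)
    done
  from wp_frame[OF this] show ?thesis by (rule wp_mono) blast
qed


declare upt_Suc [simp del]

text \<open>Only cells in front of \<open>w\<close> are described; those behind hold discarded
  candidates. The list \<open>bs\<close> of \<open>greedy\<close> has no counterpart in memory and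
  serves the counting alone.\<close>

definition rep :: "(nat list \<times> (nat \<times> nat) list) list \<Rightarrow> nat \<Rightarrow> nat \<Rightarrow> state \<Rightarrow> bool" where
  "rep D a c s \<longleftrightarrow> parsed s \<and> scalar s ''a'' = PB + a \<and> scalar s ''cg'' = c
     \<and> scalar s ''w'' = Suc (length (concat (map enc_part D)))
     \<and> map (arr s ''output'') [1..<Suc (length (concat (map enc_part D)))] = concat (map enc_part D)"

text \<open>\<open>rep\<close> survives for the old \<open>D\<close> because cells in front of
  \<open>w\<close> are preserved. The new part joins \<open>D\<close> only when the caller moves
  \<open>w\<close> to \<open>pos\<close>.\<close>

lemma wp_emit_rep:
  assumes rep: "rep D a0 c0 s"
    and "scalar s ''lo'' = PB + a" "scalar s ''hi'' = PB + b" "a \<le> b" "b < length p"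
    and "scalar s ''c'' = c" "c < n" "scalar s ''rad'' = r" "r \<le> b - a"
  shows "wp emit s (\<lambda>t s'. t \<le> t_emit \<and> rep D a0 c0 s' \<and>
     scalar s' ''cnt'' = length (snd (part a b c r)) \<and>
     scalar s' ''pos'' = Suc (length (concat (map enc_part (D @ [part a b c r])))) \<and>
     map (arr s' ''output'') [1..<Suc (length (concat (map enc_part (D @ [part a b c r]))))] =
       concat (map enc_part (D @ [part a b c r])) \<and>
     (\<forall>x\<in>{''lo'', ''hi'', ''c'', ''rad'', ''a'', ''j'', ''N'', ''cg''}. scalar s' x = scalar s x))"
proof (rule wp_mono[OF wp_emit[OF _ assms(2-8), of "concat (map enc_part D)"]], goal_cases)
  case 1
  then show ?case using rep by (simp add: rep_def)
next
  case 2
  then show ?case using assms(5,9) length_p by simp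
next
  case 3
  then show ?case using rep by (simp add: rep_def)
next
  case 4
  then show ?case using rep by (simp add: rep_def)
next
  case (5 t s')
  then have frame: "frame emit s s'" by blast
  note frame' = frame[unfolded emit_def mark_ball_def relax_all_def relax_edge_def scan_faults_def
      write_path_def write_faults_def frame_def, simplified]
  have keep: "\<forall>x\<in>{''lo'', ''hi'', ''c'', ''rad'', ''a'', ''j'', ''N'', ''cg'', ''w''}. scalar s' x = scalar s x"
    using frame' by simp
  have "parsed s'" using frame' rep by (simp add: parsed_def rep_def)
  moreover have "scalar s ''w'' = Suc (length (concat (map enc_part D)))"
    using rep by (simp add: rep_def)
  moreover from this have "map (arr s' ''output'') [1..<Suc (length (concat (map enc_part D)))] = concat (map enc_part D)"
    using 5 by metis
  ultimately have "rep D a0 c0 s'" using rep keep by (simp add: rep_def)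
  moreover have X: "concat (map enc_part (D @ [part a b c r])) = concat (map enc_part D) @ enc_part (part a b c r)"
    by simp
  moreover have "map (arr s' ''output'') [1..<Suc (length (concat (map enc_part (D @ [part a b c r]))))] =
      concat (map enc_part (D @ [part a b c r]))"
    unfolding X using 5 by metis
  ultimately show ?case using 5 keep by simp
qed

abbreviation "t_cut \<equiv> 2 * t_emit + 50"

lemma wp_cut:
  assumes rep: "rep D a c s" and g: "greedy D bs a c j" and j: "Suc j < length p"
    and s: "scalar s ''j'' = PB + Suc j" "scalar s ''N'' = Suc (length D)"
  shows "wp cut s (\<lambda>t s'. t \<le> t_cut \<and>
     rep (D @ [part a j c (j - a), part j (Suc j) c 0]) (Suc j) (p ! Suc j) s' \<and>
     scalar s' ''j'' = PB + Suc j \<and> scalar s' ''N'' = length D + 3)"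
proof -
  have a: "a \<le> j" and c: "c = p ! a \<or> c = p ! j" using g by (auto simp: greedy_def)
  have cn: "c < n" using c p_nth a j by auto
  show ?thesis
    unfolding cut_def wp_Seq[of "Assign _ _"] wp_Seq[of emit] wp_Assign
  proof (rule wp_mono[OF wp_emit_rep[where D = D and ?a0.0 = a and ?c0.0 = c and a = a and b = j
        and c = c and r = "j - a"]], goal_cases)
    case 1
    then show ?case using rep by (simp add: rep_def parsed_def)
  next
    case (10 t1 s1)
    show ?case
    proof (rule wp_mono[OF wp_emit_rep[where D = "D @ [part a j c (j - a)]" and ?a0.0 = a and ?c0.0 = c
          and a = j and b = "Suc j" and c = c and r = 0]], goal_cases)
      case 1
      then show ?case using 10 by (simp add: rep_def parsed_def)
    next
      case (10 t2 s2)
      have "inp (PB + Suc j) = p ! Suc j" using inp_p[OF j] by simp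
      then show ?case
        using 10 \<open>t1 \<le> _ \<and> _\<close> s by (simp add: rep_def parsed_def add.commute del: upt_Suc)
    qed (use 10 rep s j cn in \<open>simp_all add: rep_def\<close>)
  qed (use rep s a j cn in \<open>simp_all add: rep_def\<close>)
qed

text \<open>Register \<open>j\<close> is one ahead of the argument \<open>j\<close>: it addresses
  the vertex to be tried next, while the open piece still ends at the previous one.\<close>

definition invariant :: "nat \<Rightarrow> state \<Rightarrow> bool" where
  "invariant j s \<longleftrightarrow> (\<exists>D bs a c. rep D a c s \<and> greedy D bs a c j \<and>
     scalar s ''j'' = PB + Suc j \<and> scalar s ''N'' = Suc (length D))"

lemma invariantI:
  "rep D a c s \<Longrightarrow> greedy D bs a c j \<Longrightarrow> scalar s ''j'' = PB + Suc j \<Longrightarrow>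
    scalar s ''N'' = Suc (length D) \<Longrightarrow> invariant j s"
  by (auto simp: invariant_def)

text \<open>Two trial runs of \<open>emit\<close>, one per centre, and two more inside
  \<open>cut\<close>.\<close>

abbreviation "t_extend \<equiv> 4 * t_emit + 150"

lemma wp_extend:
  assumes inv: "invariant j s" and j: "Suc j < length p"
  shows "wp extend s (\<lambda>t s'. t \<le> t_extend \<and> invariant (Suc j) s')"
proof -
  obtain D bs a c where rep: "rep D a c s" and g: "greedy D bs a c j"
    and s: "scalar s ''j'' = PB + Suc j" "scalar s ''N'' = Suc (length D)"
    using inv by (auto simp: invariant_def)
  have a: "a \<le> j" using g by (simp add: greedy_def)
  have pa: "arr s ''input'' (PB + a) = p ! a" "p ! a < n" and pj: "inp (PB + Suc j) = p ! Suc j" "p ! Suc j < n"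
    using rep inp_p[of a] inp_p[OF j] p_nth a j by (simp_all add: rep_def parsed_def)
  show ?thesis
    unfolding extend_def wp_Seq[of "Assign _ _"] wp_Seq[of emit] wp_Seq[of "Cond _ _ _"] wp_Assign
  proof (rule wp_mono[OF wp_emit_rep[where D = D and ?a0.0 = a and ?c0.0 = c and a = a and b = "Suc j"
        and c = "p ! a" and r = "Suc j - a"]], goal_cases)
    case 1
    then show ?case using rep by (simp add: rep_def parsed_def)
  next
    case (10 t1 s1)
    have sa: "scalar s ''a'' = PB + a" "arr s ''input'' = inp" "inp (PB + a) = p ! a"
      using rep pa by (simp_all add: rep_def parsed_def)
    from 10 have t1: "t1 \<le> t_emit" by blast
    from 10 have rep1: "rep D a c s1" and B1: "scalar s1 ''B'' = length fs div k"
      and s1: "scalar s1 ''j'' = PB + Suc j" "scalar s1 ''N'' = Suc (length D)" "scalar s1 ''c'' = p ! a"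
        "scalar s1 ''lo'' = PB + a" "scalar s1 ''hi'' = PB + Suc j" "scalar s1 ''rad'' = Suc j - a"
        "scalar s1 ''cnt'' = length (snd (part a (Suc j) (p ! a) (Suc j - a)))"
      using s by (simp_all add: sa rep_def parsed_def)
    show ?case
    proof (cases "few (part a (Suc j) (p ! a) (Suc j - a))")
      case True
      then have "greedy D bs a (p ! a) (Suc j)" using greedy_extend[OF g j] by blast
      then have "invariant (Suc j)
          (s1\<lparr>scalar := (scalar s1)(''cg'' := scalar s1 ''c'', ''j'' := Suc (scalar s1 ''j''))\<rparr>)"
        by (rule invariantI[rotated]) (use rep1 s1 in \<open>simp_all add: rep_def parsed_def\<close>)
      then show ?thesis
        using t1 True s1(7) B1 by (simp add: few_def)
    next
      case not_few1: False
      then have cond1: "bval (Less (Var ''B'') (Var ''cnt'')) s1"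
        using s1(7) B1 by (simp add: few_def)
      show ?thesis
        unfolding wp_Cond if_P[OF cond1] wp_Seq[of "Assign _ _"] wp_Seq[of emit] wp_Assign
      proof (rule wp_mono[OF wp_emit_rep[where D = D and ?a0.0 = a and ?c0.0 = c and a = a and b = "Suc j"
            and c = "p ! Suc j" and r = "Suc j - a"]], goal_cases)
        case 1
        then show ?case using rep1 by (simp add: rep_def parsed_def)
      next
        case (10 t2 s2)
        then have rep2: "rep D a c s2" and B2: "scalar s2 ''B'' = length fs div k"
          and s2: "scalar s2 ''j'' = PB + Suc j" "scalar s2 ''N'' = Suc (length D)" "scalar s2 ''c'' = p ! Suc j"
            "scalar s2 ''cnt'' = length (snd (part a (Suc j) (p ! Suc j) (Suc j - a)))"
          using s1 rep1 pj by (simp_all add: rep_def parsed_def)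
        show ?case
        proof (cases "few (part a (Suc j) (p ! Suc j) (Suc j - a))")
          case True
          then have "greedy D bs a (p ! Suc j) (Suc j)" using greedy_extend[OF g j] by blast
          then have "invariant (Suc j)
              (s2\<lparr>scalar := (scalar s2)(''cg'' := scalar s2 ''c'', ''j'' := Suc (scalar s2 ''j''))\<rparr>)"
            by (rule invariantI[rotated]) (use rep2 s2 in \<open>simp_all add: rep_def parsed_def\<close>)
          moreover have "t1 \<le> t_emit" "t2 \<le> t_emit" using 10 t1 by blast+
          ultimately show ?thesis
            using True s2(4) B2 by (simp add: few_def)
        next
          case not_few2: False
          then have cond2: "bval (Less (Var ''B'') (Var ''cnt'')) s2"
            using s2(4) B2 by (simp add: few_def)
          have g': "greedy (D @ [part a j c (j - a), part j (Suc j) c 0]) (bs @ [Suc j]) (Suc j) (p ! Suc j) (Suc j)"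
            using not_few1 not_few2 by (intro greedy_cut[OF g j]) auto
          show ?thesis
            unfolding if_P[OF cond2]
          proof (rule wp_mono[OF wp_cut[OF rep2 g j s2(1,2)]], goal_cases)
            case (1 t3 s3)
            let ?D = "D @ [part a j c (j - a), part j (Suc j) c 0]"
            from g' have "invariant (Suc j) (s3\<lparr>scalar := (scalar s3)(''j'' := Suc (scalar s3 ''j''))\<rparr>)"
              by (rule invariantI[rotated]) (use 1 in \<open>simp_all add: rep_def parsed_def\<close>)
            moreover have "t1 \<le> t_emit" "t2 \<le> t_emit" "t3 \<le> t_cut" using 10 t1 1 by blast+
            ultimately show ?case by simp
          qed
        qed
      qed (use 10 rep1 s1 a j pj in \<open>simp_all add: rep_def parsed_def\<close>)
    qed
  qed (use rep s a j pa in \<open>simp_all add: rep_def parsed_def Suc_diff_le\<close>)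
qed


lemma wp_parse:
  assumes "arr s ''input'' = inp"
  shows "wp parse s (\<lambda>t s'. t \<le> t_div + 60 \<and> parsed s')"
proof -
  have suc: "inp (Suc (Suc (Suc (2 * length es + 2 * length fs)))) = length p"
    "inp (Suc (Suc (Suc (Suc (2 * length es + 2 * length fs + length p))))) = k"
    using inp_p_len inp_k by (simp_all add: eval_nat_numeral)
  show ?thesis
    unfolding parse_def wp_Seq[of "Assign _ _"] wp_Assign
  proof (rule wp_mono[OF wp_divide_faults], goal_cases)
    case (4 t s')
    then show ?case
      using assms inp_es_len inp_fs_len suc(1)
      by (simp add: parsed_def frame_def divide_faults_def flip: mult_2)
  qed (use assms inp_es_len inp_fs_len suc in \<open>simp_all flip: mult_2\<close>)
qed

abbreviation "t_decompose \<equiv> t_div + length p * (t_extend + 10) + t_emit + 200"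

lemma enc_output_eq: "enc_output out = length out # concat (map enc_part out)"
proof -
  have "enc_part = (\<lambda>(q, gs). enc_path q @ enc_edges gs)" by (auto simp: enc_part_def)
  then show ?thesis by (simp add: enc_output_def)
qed

lemma wp_decompose:
  assumes "arr s ''input'' = inp"
  shows "wp decompose s (\<lambda>t s'. t \<le> t_decompose \<and>
    (\<exists>out. output_of s' = enc_output out \<and> path_partition p (map fst out) \<and>
       (\<forall>x\<in>set out. good_part x) \<and> out \<noteq> [] \<and> length out \<le> 8 * k + 1))"
  unfolding decompose_def wp_Seq[of parse] wp_Seq[of "Assign _ _"] wp_Seq[of "While _ _"] wp_Seq[of emit]
    wp_Seq[of "Store _ _ _"] wp_Assign wp_Store
proof (rule wp_mono[OF wp_parse[OF assms]], goal_cases)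
  case (1 t1 s1)
  then have s1: "parsed s1" and t1: "t1 \<le> t_div + 60" by blast+
  have p0: "inp (4 + (2 * length es + 2 * length fs)) = p ! 0"
    using inp_p[of 0] p_neq_Nil by (simp add: add.assoc)
  show ?case
  \<comment> \<open>One round per edge of the path, as the open piece initially consists of vertex
    0.\<close>
  proof (rule wp_mono[OF wp_while[where I = invariant and n = "length p - 1" and T = t_extend]], goal_cases)
    case 1
    show ?case
      by (rule invariantI[OF _ greedy_init]) (use s1 p0 in \<open>simp_all add: rep_def parsed_def\<close>)
  next
    case (2 j s2)
    then obtain D a c where "rep D a c s2" "scalar s2 ''j'' = PB + Suc j"
      by (auto simp: invariant_def)
    then have "bval (Less (Var ''j'') (Var ''PE'')) s2"
      using 2(1) by (simp add: rep_def parsed_def)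
    then show ?case using wp_extend[OF 2(2)] 2(1) by simp
  next
    case (3 s2)
    then show ?case using p_neq_Nil by (auto simp: invariant_def rep_def parsed_def)
  next
    case (4 t2 s2)
    define j where "j = length p - 1"
    have j: "j < length p" "Suc j = length p" using p_neq_Nil by (simp_all add: j_def)
    from 4 obtain D bs a c where rep: "rep D a c s2" and g: "greedy D bs a c j"
      and N: "scalar s2 ''N'' = Suc (length D)" and t2: "t2 \<le> j * (t_extend + 4) + 4"
      by (auto simp: invariant_def j_def)
    have a: "a \<le> j" using g by (simp add: greedy_def)
    have c: "c < n" using g p_nth[of a] p_nth[of j] j by (auto simp: greedy_def)
    let ?out = "D @ [part a j c (j - a)]"
    have sa: "scalar s2 ''a'' = PB + a" "scalar s2 ''cg'' = c" using rep by (simp_all add: rep_def)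
    have PE: "scalar s2 ''PE'' = Suc (PB + j)" using rep by (simp add: rep_def parsed_def flip: j(2))
    show ?case
    proof (rule wp_mono[OF wp_emit_rep[where D = D and ?a0.0 = a and ?c0.0 = c and a = a and b = j
          and c = c and r = "j - a"]], goal_cases)
      case 1
      then show ?case using rep by (simp add: rep_def parsed_def)
    next
      case (10 t3 s3)
      define X where "X = concat (map enc_part ?out)"
      have X: "map (arr s3 ''output'') [1..<Suc (length X)] = X" "scalar s3 ''pos'' = Suc (length X)"
        "scalar s3 ''N'' = length ?out"
        using 10 N unfolding X_def by simp_all
      have "[0..<Suc (length X)] = 0 # [1..<Suc (length X)]" by (simp add: upt_conv_Cons)
      then have "output_of (s3\<lparr>arr := (arr s3)(''output'' := (arr s3 ''output'')(0 := scalar s3 ''N'')),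
          scalar := (scalar s3)(''output'' := scalar s3 ''pos'')\<rparr>) = enc_output ?out"
        unfolding output_of_def enc_output_eq X_def[symmetric]
        by (simp add: X del: One_nat_def)
      moreover have "t1 + t2 + t3 + 100 \<le> t_decompose"
      proof -
        have "j * (t_extend + 4) \<le> length p * (t_extend + 10)" using j by (intro mult_le_mono) auto
        moreover have "t3 \<le> t_emit" using 10 by blast
        ultimately show ?thesis using t1 t2 by linarith
      qed
      ultimately show ?case
        using greedy_finish[OF g j(2)] by (intro conjI exI[of _ ?out]) simp_all
    qed (use a c j(1) in \<open>simp_all add: PE sa\<close>)
  qed
qed

section \<open>Running time in terms of vertices and faults\<close>

lemma length_es: "length es \<le> n * n"
proof -
  have "E \<subseteq> (\<lambda>(u, v). {u, v}) ` ({..<n} \<times> {..<n})"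
  proof
    fix e assume "e \<in> E"
    then have "e \<subseteq> {..<n}" "card e = 2" using G by (auto simp: ugraph_def)
    then obtain u v where "e = {u, v}" "u < n" "v < n" by (auto simp: card_2_iff)
    then show "e \<in> (\<lambda>(u, v). {u, v}) ` ({..<n} \<times> {..<n})" by force
  qed
  then have "card E \<le> card ({..<n} \<times> {..<n})" by (intro surj_card_le) auto
  then show ?thesis using length_lists_edges[OF es] by (simp add: card_cartesian_product)
qed

text \<open>A relaxation round scans the faults for each of at most \<open>n * n\<close> edges,
  which gives degree 3. A ball needs up to \<open>n\<close> rounds and the main loop up to
  \<open>n\<close> emissions of constant multiplicity, each adding one to the degree.\<close>

lemma t_decompose_le: "t_decompose \<le> 4000 * (n + length fs + 1) ^ 5"
proof -
  define M where "M = n + length fs + 1"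
  have M: "1 \<le> M" "n \<le> M" "length fs \<le> M" by (simp_all add: M_def)
  have pow: "M ^ i \<le> M ^ j" if "i \<le> j" for i j using that M(1) by (rule power_increasing)
  have "length es \<le> M * M" using length_es mult_le_mono[OF M(2) M(2)] by linarith
  moreover have "t_relax + 10 \<le> 140 * M" using M by linarith
  ultimately have "length es * (t_relax + 10) \<le> (M * M) * (140 * M)" by (rule mult_le_mono)
  also have "\<dots> = 140 * M ^ 3" by (simp add: power3_eq_cube)
  finally have round: "t_round + 20 \<le> 180 * M ^ 3"
    using one_le_power[OF M(1), of 3] by linarith
  have "n * (t_round + 20) \<le> M * (180 * M ^ 3)" by (rule mult_le_mono[OF M(2) round])
  also have "\<dots> = 180 * M ^ 4" by (simp add: power_numeral_reduce)
  finally have emit: "t_emit \<le> 400 * M ^ 4"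
    using M one_le_power[OF M(1), of 4] pow[of 1 4] by simp
  have "length p \<le> M" using length_p M(2) by linarith
  moreover have "4 * e + 150 + 10 \<le> 2000 * M ^ 4" if "e \<le> 400 * M ^ 4" for e
    using that one_le_power[OF M(1), of 4] by linarith
  from this[OF emit] have "t_extend + 10 \<le> 2000 * M ^ 4" .
  ultimately have "length p * (t_extend + 10) \<le> M * (2000 * M ^ 4)" by (rule mult_le_mono)
  also have "\<dots> = 2000 * M ^ 5" by (simp add: power_numeral_reduce)
  finally have loop: "length p * (t_extend + 10) \<le> 2000 * M ^ 5" .
  have "length fs div k \<le> M" using M(3) div_le_dividend le_trans by blast
  then show ?thesis
    using loop emit one_le_power[OF M(1), of 5] pow[of 1 5] pow[of 4 5]
    unfolding M_def[symmetric] by simp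
qed

end

section \<open>Positions in the encoded input\<close>

lemma nth_flatten_pairs:
  "i < length es \<Longrightarrow> concat (map (\<lambda>(u, v). [u, v]) es) ! (2 * i) = fst (es ! i)"
  "i < length es \<Longrightarrow> concat (map (\<lambda>(u, v). [u, v]) es) ! Suc (2 * i) = snd (es ! i)"
  by (induction es arbitrary: i; case_tac i; auto simp: nth_Cons')+

lemma length_flatten_pairs: "length (concat (map (\<lambda>(u, v). [u, v]) es)) = 2 * length es"
  by (induction es) auto

lemma nth_append_middle:
  "m = length xs \<Longrightarrow> i < length ys \<Longrightarrow> (xs @ ys @ zs) ! (m + i) = ys ! i"
  by (simp add: nth_append)

lemma fault_instance_enc_input:
  assumes "ugraph {..<n} E" "F \<subseteq> E" "shortest_path {..<n} (E - F) p" "1 \<le> k"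
    "lists_edges es E" "lists_edges fs F"
  shows "fault_instance n E F p k es fs (arr (init_state (enc_input n es fs p k)) ''input'')"
proof -
  define A where "A = concat (map (\<lambda>(u, v). [u, v]) es)"
  define B where "B = concat (map (\<lambda>(u, v). [u, v]) fs)"
  define xs where "xs = enc_input n es fs p k"
  have len: "length A = 2 * length es" "length B = 2 * length fs"
    by (simp_all add: A_def B_def length_flatten_pairs)
  have xs: "xs = [n, length es] @ A @ [length fs] @ B @ [length p] @ p @ [k]"
    by (simp add: xs_def enc_input_def enc_edges_def enc_path_def A_def B_def)
  have lxs: "length xs = 5 + 2 * length es + 2 * length fs + length p"
    by (simp add: xs len)
  have inp: "arr (init_state xs) ''input'' i = xs ! i" if "i < length xs" for i
    using that by (simp add: init_state_def)
  have A: "xs ! (2 + i) = A ! i" if "i < length A" for i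
    unfolding xs by (rule nth_append_middle) (use that in auto)
  have B: "xs ! (3 + 2 * length es + i) = B ! i" if "i < length B" for i
    using nth_append_middle[of "3 + 2 * length es" "[n, length es] @ A @ [length fs]" i B "[length p] @ p @ [k]"] that
    by (simp add: xs len)
  have P: "xs ! (4 + 2 * length es + 2 * length fs + i) = p ! i" if "i < length p" for i
    using nth_append_middle[of "4 + 2 * length es + 2 * length fs"
        "[n, length es] @ A @ [length fs] @ B @ [length p]" i p "[k]"] that
    by (simp add: xs len)
  have 1: "xs ! (2 + 2 * length es) = length fs"
    using nth_append_middle[of "2 + 2 * length es" "[n, length es] @ A" 0 "[length fs]" "B @ [length p] @ p @ [k]"]
    by (simp add: xs len)
  have 2: "xs ! (3 + 2 * length es + 2 * length fs) = length p"
    using nth_append_middle[of "3 + 2 * length es + 2 * length fs"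
        "[n, length es] @ A @ [length fs] @ B" 0 "[length p]" "p @ [k]"]
    by (simp add: xs len)
  have 3: "xs ! (4 + 2 * length es + 2 * length fs + length p) = k"
    using nth_append_middle[of "4 + 2 * length es + 2 * length fs + length p"
        "[n, length es] @ A @ [length fs] @ B @ [length p] @ p" 0 "[k]" "[]"]
    by (simp add: xs len)
  show ?thesis
    unfolding xs_def[symmetric]
  proof
    show "arr (init_state xs) ''input'' 0 = n" "arr (init_state xs) ''input'' 1 = length es"
      using inp lxs by (simp_all add: xs)
    show "arr (init_state xs) ''input'' (2 + 2 * i) = fst (es ! i) \<and>
        arr (init_state xs) ''input'' (2 + 2 * i + 1) = snd (es ! i)" if "i < length es" for i
      using A[of "2 * i"] A[of "Suc (2 * i)"] that nth_flatten_pairs[OF that] lxs len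
      by (simp add: inp A_def)
    show "arr (init_state xs) ''input'' (3 + 2 * length es + 2 * i) = fst (fs ! i) \<and>
        arr (init_state xs) ''input'' (3 + 2 * length es + 2 * i + 1) = snd (fs ! i)" if "i < length fs" for i
      using B[of "2 * i"] B[of "Suc (2 * i)"] that nth_flatten_pairs[OF that] lxs len
      by (simp add: inp B_def)
    show "arr (init_state xs) ''input'' (4 + 2 * length es + 2 * length fs + i) = p ! i" if "i < length p" for i
      using P[OF that] that lxs by (simp add: inp)
  qed (use assms 1 2 3 lxs in \<open>simp_all add: inp\<close>)
qed

theorem theorem1p7:
  "\<exists>(alg :: com) (C :: real) (a :: nat) (d :: nat).
     \<forall>(n :: nat) (E :: nat set set) (F :: nat set set) (\<pi> :: nat list) (k :: nat)
       (es :: (nat \<times> nat) list) (fs :: (nat \<times> nat) list).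
       ugraph {..<n} E \<and> F \<subseteq> E \<and> shortest_path {..<n} (E - F) \<pi> \<and> k \<ge> 1
         \<and> lists_edges es E \<and> lists_edges fs F \<longrightarrow>
       (\<exists>(q :: nat) (out :: (nat list \<times> (nat \<times> nat) list) list) (t :: nat).
          computes_in alg (enc_input n es fs \<pi> k) (enc_output out) t
          \<and> t \<le> a * (n + card F + 1) ^ d
          \<and> length out = q + 1
          \<and> real q \<le> C * real k
          \<and> path_partition \<pi> (map fst out)
          \<and> (\<forall>i\<le>q. let \<pi>\<^sub>i = fst (out ! i); F\<^sub>i = edge_set (snd (out ! i)) in
               F\<^sub>i \<subseteq> F
               \<and> real (card F\<^sub>i) \<le> real (card F) / real k
               \<and> shortest_path {..<n} (E - F\<^sub>i) \<pi>\<^sub>i))"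
proof (rule exI[of _ decompose], rule exI[of _ 8], rule exI[of _ 4000], rule exI[of _ 5],
    intro allI impI, elim conjE)
  fix n k :: nat and E F :: "nat set set" and \<pi> :: "nat list" and es fs :: "(nat \<times> nat) list"
  assume asm: "ugraph {..<n} E" "F \<subseteq> E" "shortest_path {..<n} (E - F) \<pi>" "1 \<le> k"
    "lists_edges es E" "lists_edges fs F"
  let ?s = "init_state (enc_input n es fs \<pi> k)"
  interpret fault_instance n E F \<pi> k es fs "arr ?s ''input''"
    using asm by (rule fault_instance_enc_input)
  from wp_decompose[OF refl] obtain t s' out where
    run: "exec decompose ?s t s'" "output_of s' = enc_output out" "t \<le> t_decompose"
    and out: "path_partition \<pi> (map fst out)" "\<forall>x\<in>set out. good_part x"
      "out \<noteq> []" "length out \<le> 8 * k + 1"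
    unfolding wp_def by blast
  have card: "card F = length fs" using length_lists_edges[OF fs] by simp
  have parts: "edge_set (snd (out ! i)) \<subseteq> F"
    "real (card (edge_set (snd (out ! i)))) \<le> real (card F) / real k"
    "shortest_path {..<n} (E - edge_set (snd (out ! i))) (fst (out ! i))"
    if "i \<le> length out - 1" for i
  proof -
    have "i < length out" using that out(3) by (cases out) auto
    then have good: "good_part (out ! i)" using out(2) by simp
    then have "card (edge_set (snd (out ! i))) \<le> card F div k"
      by (simp add: good_part_def card)
    then have "real (card (edge_set (snd (out ! i)))) \<le> real (card F div k)" by simp
    \<comment> \<open>The program compares with the floor, which is at most the real
      quotient.\<close>
    also have "\<dots> \<le> real (card F) / real k" by (rule of_nat_div_le_of_nat)
    finally show "real (card (edge_set (snd (out ! i)))) \<le> real (card F) / real k" .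
    show "edge_set (snd (out ! i)) \<subseteq> F"
      "shortest_path {..<n} (E - edge_set (snd (out ! i))) (fst (out ! i))"
      using good by (simp_all add: good_part_def)
  qed
  show "\<exists>q out t. computes_in decompose (enc_input n es fs \<pi> k) (enc_output out) t \<and>
      t \<le> 4000 * (n + card F + 1) ^ 5 \<and> length out = q + 1 \<and> real q \<le> 8 * real k \<and>
      path_partition \<pi> (map fst out) \<and>
      (\<forall>i\<le>q. let \<pi>\<^sub>i = fst (out ! i); F\<^sub>i = edge_set (snd (out ! i)) in
         F\<^sub>i \<subseteq> F \<and> real (card F\<^sub>i) \<le> real (card F) / real k
         \<and> shortest_path {..<n} (E - F\<^sub>i) \<pi>\<^sub>i)"
  proof (intro exI conjI)
    show "computes_in decompose (enc_input n es fs \<pi> k) (enc_output out) t"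
      using run by (auto simp: computes_in_def)
    show "t \<le> 4000 * (n + card F + 1) ^ 5"
      using run(3) t_decompose_le card by simp
    \<comment> \<open>Parts are numbered from 0, so the final open piece does not add to q and the
      bound stays at 8 k.\<close>
    show "length out = (length out - 1) + 1" using out(3) by (cases out) auto
    show "real (length out - 1) \<le> 8 * real k" using out(4) by linarith
    show "path_partition \<pi> (map fst out)" by fact
    show "\<forall>i\<le>length out - 1. let \<pi>\<^sub>i = fst (out ! i); F\<^sub>i = edge_set (snd (out ! i)) in
         F\<^sub>i \<subseteq> F \<and> real (card F\<^sub>i) \<le> real (card F) / real k
         \<and> shortest_path {..<n} (E - F\<^sub>i) \<pi>\<^sub>i"
      using parts by (simp add: Let_def)
  qed
qed

end
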